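(* Let $m,n\in\mathbb{N}$, let $0<p<1$, and let $\Phi: M_m(\mathbb{C})\to M_n(\mathbb{C})$ be a unital Schwarz map such that $\Phi^\dagger(\mathbf{1})\in M_m^{++}(\mathbb{C})$. Then for any $A\in M_n^{++}(\mathbb{C})$ and any invertible $B\in M_n(\mathbb{C})$, $$\operatorname{Tr}\left[\left(B^*A^{-p}B\right)^{1/(2-p)}\right]\ge \operatorname{Tr}\left[\left(\Phi^\dagger(B)^*\,\Phi^\dagger(A)^{-p}\,\Phi^\dagger(B)\right)^{1/(2-p)}\right].$$
   Context: $M_n(\mathbb{C})$ denotes the $n\times n$ complex matrices and $M_n^{++}(\mathbb{C})$ the open cone of positive definite matrices in $M_n(\mathbb{C})$; $\mathbf{1}$ is the identity matrix. Each $M_n(\mathbb{C})$ carries the Hilbert–Schmidt inner product $\langle X,Y\rangle=\operatorname{Tr}[X^*Y]$, and $\Phi^\dagger: M_n(\mathbb{C})\to M_m(\mathbb{C})$ is the adjoint of $\Phi$ with respect to these inner products. A Schwarz map is a linear map $\Phi: M_m(\mathbb{C})\to M_n(\mathbb{C})$ such that $\Phi(X^*X)\ge \Phi(X)^*\Phi(X)$ for all $X\in M_m(\mathbb{C})$. $\Phi$ is unital if $\Phi(\mathbf{1})=\mathbf{1}$. *)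

theory Defs
  imports "HOL-Analysis.Analysis"
begin

text \<open>
  The order on the complex numbers is that of HOL-Library.Complex_Order:
  \<open>z \<le> w\<close> iff \<open>Re z \<le> Re w\<close> and \<open>Im z = Im w\<close>. In particular \<open>0 \<le> z\<close> says that \<open>z\<close> is real
  and nonnegative.
\<close>

definition madj :: "complex^'n^'m \<Rightarrow> complex^'m^'n" where
  "madj A = (\<chi> i j. cnj (A $ j $ i))"

definition mscale :: "complex \<Rightarrow> complex^'n^'m \<Rightarrow> complex^'n^'m" where
  "mscale c A = (\<chi> i j. c * A $ i $ j)"

definition cinner :: "complex^'n \<Rightarrow> complex^'n \<Rightarrow> complex" where
  "cinner x y = (\<Sum>i\<in>UNIV. cnj (x $ i) * y $ i)"

definition psd :: "complex^'n^'n \<Rightarrow> bool" where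
  "psd A \<longleftrightarrow> madj A = A \<and> (\<forall>x. 0 \<le> cinner x (A *v x))"

definition posdef :: "complex^'n^'n \<Rightarrow> bool" where
  "posdef A \<longleftrightarrow> madj A = A \<and> (\<forall>x. x \<noteq> 0 \<longrightarrow> 0 < cinner x (A *v x))"

definition loewner_le :: "complex^'n^'n \<Rightarrow> complex^'n^'n \<Rightarrow> bool" where
  "loewner_le A B \<longleftrightarrow> psd (B - A)"


definition unitary :: "complex^'n^'n \<Rightarrow> bool" where
  "unitary U \<longleftrightarrow> madj U ** U = mat 1 \<and> U ** madj U = mat 1"

definition rdiag :: "('n \<Rightarrow> real) \<Rightarrow> complex^'n^'n" where
  "rdiag d = (\<chi> i j. if i = j then complex_of_real (d i) else 0)"

text \<open>
  Real powers by functional calculus: diagonalize \<open>A\<close> by a unitary and raise the eigenvalues to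
  the power \<open>t\<close>. This is the usual \<open>A\<^sup>t\<close> for positive definite \<open>A\<close> and any real \<open>t\<close>, and
  for positive semidefinite \<open>A\<close> and \<open>t > 0\<close> (note that \<open>0 powr t = 0\<close>); it should only be
  used in these cases. That the value does not depend on the diagonalization is \<open>mpow_eq\<close> below.
\<close>

definition mpow :: "complex^'n^'n \<Rightarrow> real \<Rightarrow> complex^'n^'n" where
  "mpow A t = (THE X. \<exists>U d. unitary U \<and> A = U ** rdiag d ** madj U \<and>
                             X = U ** rdiag (\<lambda>i. d i powr t) ** madj U)"

lemma rdiag_mult_left: "(rdiag d ** (A :: complex^'n^'n)) $ i $ j = of_real (d i) * A $ i $ j"
  by (simp add: rdiag_def matrix_matrix_mult_def if_distrib[of "\<lambda>z. z * _"] cong: if_cong)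

lemma rdiag_mult_right: "((A :: complex^'n^'n) ** rdiag d) $ i $ j = A $ i $ j * of_real (d j)"
  by (simp add: rdiag_def matrix_matrix_mult_def if_distrib[of "\<lambda>z. _ * z"] cong: if_cong)

lemma rdiag_fun_unique:
  fixes U V :: "complex^'n^'n"
  assumes U: "unitary U" and V: "unitary V"
    and eq: "U ** rdiag d ** madj U = V ** rdiag e ** madj V"
  shows "U ** rdiag (\<lambda>i. f (d i)) ** madj U = V ** rdiag (\<lambda>i. f (e i)) ** madj V"
proof -
  define W where "W = madj V ** U"
  have UU: "madj U ** U = mat 1" "U ** madj U = mat 1"
    and VV: "madj V ** V = mat 1" "V ** madj V = mat 1"
    using U V by (auto simp: unitary_def)
  have VW: "V ** W = U"
    by (simp add: W_def matrix_mul_assoc VV)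
  have WU: "W ** madj U = madj V"
    by (simp add: W_def matrix_mul_assoc[symmetric] UU)
  have "W ** rdiag d = madj V ** (U ** rdiag d ** madj U) ** U"
    by (simp add: W_def matrix_mul_assoc[symmetric] UU)
  also have "\<dots> = madj V ** (V ** rdiag e ** madj V) ** U"
    by (simp only: eq)
  also have "\<dots> = rdiag e ** W"
    by (simp add: W_def matrix_mul_assoc VV)
  finally have comm: "W ** rdiag d = rdiag e ** W" .
  have "W ** rdiag (\<lambda>i. f (d i)) = rdiag (\<lambda>i. f (e i)) ** W"
  proof -
    have "W $ i $ j * of_real (f (d j)) = of_real (f (e i)) * W $ i $ j" for i j
    proof -
      have "W $ i $ j * of_real (d j) = of_real (e i) * W $ i $ j"
        using arg_cong[OF comm, of "\<lambda>M. M $ i $ j"]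
        by (simp only: rdiag_mult_left rdiag_mult_right)
      then have "W $ i $ j = 0 \<or> d j = e i"
        by (simp add: mult.commute)
      then show ?thesis
        by auto
    qed
    then show ?thesis
      by (simp add: vec_eq_iff rdiag_mult_left rdiag_mult_right)
  qed
  then have "V ** (W ** rdiag (\<lambda>i. f (d i))) ** madj U = V ** (rdiag (\<lambda>i. f (e i)) ** W) ** madj U"
    by simp
  then show ?thesis
    by (metis VW WU matrix_mul_assoc)
qed

lemma mpow_eq:
  assumes "unitary U" and "A = U ** rdiag d ** madj U"
  shows "mpow A t = U ** rdiag (\<lambda>i. d i powr t) ** madj U"
  unfolding mpow_def
proof (rule the_equality)
  show "\<exists>V e. unitary V \<and> A = V ** rdiag e ** madj V \<and>
          U ** rdiag (\<lambda>i. d i powr t) ** madj U = V ** rdiag (\<lambda>i. e i powr t) ** madj V"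
    using assms by blast
next
  fix X
  assume "\<exists>V e. unitary V \<and> A = V ** rdiag e ** madj V \<and>
            X = V ** rdiag (\<lambda>i. e i powr t) ** madj V"
  then obtain V e where V: "unitary V" "A = V ** rdiag e ** madj V"
    and X: "X = V ** rdiag (\<lambda>i. e i powr t) ** madj V"
    by blast
  show "X = U ** rdiag (\<lambda>i. d i powr t) ** madj U"
    unfolding X
    by (rule rdiag_fun_unique[where f = "\<lambda>x. x powr t"]) (use assms V in auto)
qed


definition hs_inner :: "complex^'n^'n \<Rightarrow> complex^'n^'n \<Rightarrow> complex" where
  "hs_inner X Y = trace (madj X ** Y)"

definition hs_adjoint ::
  "(complex^'m^'m \<Rightarrow> complex^'n^'n) \<Rightarrow> (complex^'n^'n \<Rightarrow> complex^'m^'m)" where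
  "hs_adjoint \<Phi> = (THE \<Psi>. \<forall>X Y. hs_inner (\<Phi> X) Y = hs_inner X (\<Psi> Y))"

definition schwarz_map :: "(complex^'m^'m \<Rightarrow> complex^'n^'n) \<Rightarrow> bool" where
  "schwarz_map \<Phi> \<longleftrightarrow> Vector_Spaces.linear mscale mscale \<Phi> \<and>
     (\<forall>X. loewner_le (madj (\<Phi> X) ** \<Phi> X) (\<Phi> (madj X ** X)))"

definition unital_map :: "(complex^'m^'m \<Rightarrow> complex^'n^'n) \<Rightarrow> bool" where
  "unital_map \<Phi> \<longleftrightarrow> \<Phi> (mat 1) = mat 1"

lemma vector_space_mscale: "vector_space (mscale :: complex \<Rightarrow> complex^'n^'m \<Rightarrow> complex^'n^'m)"
  by unfold_locales (simp_all add: mscale_def vec_eq_iff algebra_simps)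

lemma hs_inner_entries: "hs_inner X Y = (\<Sum>i\<in>UNIV. \<Sum>j\<in>UNIV. cnj (X $ i $ j) * Y $ i $ j)"
  unfolding hs_inner_def trace_def madj_def matrix_matrix_mult_def
  by (simp, rule sum.swap)

lemma hs_inner_add_left: "hs_inner (X + Y) Z = hs_inner X Z + hs_inner Y Z"
  by (simp add: hs_inner_entries algebra_simps sum.distrib)

lemma hs_inner_mscale_left: "hs_inner (mscale c X) Z = cnj c * hs_inner X Z"
  by (simp add: hs_inner_entries mscale_def sum_distrib_left algebra_simps)

lemma hs_inner_zero_left: "hs_inner 0 Z = 0"
  by (simp add: hs_inner_entries)

lemma hs_inner_sum_left: "hs_inner (\<Sum>a\<in>S. F a) Z = (\<Sum>a\<in>S. hs_inner (F a) Z)"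
  by (induction S rule: infinite_finite_induct) (simp_all add: hs_inner_add_left hs_inner_zero_left)

text \<open>For linear \<open>\<Phi>\<close> the defining property of the adjoint determines it uniquely.\<close>

lemma hs_adjoint_ex1:
  fixes \<Phi> :: "complex^'m^'m \<Rightarrow> complex^'n^'n"
  assumes "Vector_Spaces.linear mscale mscale \<Phi>"
  shows "\<exists>!\<Psi>. \<forall>X Y. hs_inner (\<Phi> X) Y = hs_inner X (\<Psi> Y)"
proof -
  interpret Vector_Spaces.linear mscale mscale \<Phi> by fact
  define E :: "'m \<Rightarrow> 'm \<Rightarrow> complex^'m^'m" where "E i j = axis i (axis j 1)" for i j
  have entry: "hs_inner (E i j) Z = Z $ i $ j" for i j Z
  proof -
    have "cnj (E i j $ a $ b) * Z $ a $ b = (if b = j then if a = i then Z $ i $ j else 0 else 0)"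
      for a b by (auto simp: E_def axis_def)
    then show ?thesis
      by (simp add: hs_inner_entries)
  qed
  have expand: "X = (\<Sum>i\<in>UNIV. \<Sum>j\<in>UNIV. mscale (X $ i $ j) (E i j))" for X
  proof -
    have "mscale (X $ i $ j) (E i j) $ a $ b = (if j = b then if i = a then X $ a $ b else 0 else 0)"
      for i j a b by (auto simp: mscale_def E_def axis_def)
    then show ?thesis
      by (simp add: vec_eq_iff)
  qed
  define \<Psi> where "\<Psi> Y = (\<chi> i j. hs_inner (\<Phi> (E i j)) Y)" for Y
  have works: "hs_inner (\<Phi> X) Y = hs_inner X (\<Psi> Y)" for X Y
  proof -
    have "hs_inner (\<Phi> X) Y = hs_inner (\<Phi> (\<Sum>i\<in>UNIV. \<Sum>j\<in>UNIV. mscale (X $ i $ j) (E i j))) Y"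
      using expand[of X] by simp
    also have "\<dots> = (\<Sum>i\<in>UNIV. \<Sum>j\<in>UNIV. cnj (X $ i $ j) * hs_inner (\<Phi> (E i j)) Y)"
      by (simp add: sum scale hs_inner_sum_left hs_inner_mscale_left)
    also have "\<dots> = hs_inner X (\<Psi> Y)"
      by (simp add: hs_inner_entries[of X] \<Psi>_def)
    finally show ?thesis .
  qed
  show ?thesis
  proof (rule ex1I[of _ \<Psi>])
    show "\<forall>X Y. hs_inner (\<Phi> X) Y = hs_inner X (\<Psi> Y)"
      using works by blast
  next
    fix \<Psi>'
    assume "\<forall>X Y. hs_inner (\<Phi> X) Y = hs_inner X (\<Psi>' Y)"
    then have "hs_inner (E i j) (\<Psi>' Y) = hs_inner (E i j) (\<Psi> Y)" for i j Y
      using works by metis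
    then show "\<Psi>' = \<Psi>"
      by (simp add: entry fun_eq_iff vec_eq_iff)
  qed
qed

lemma hs_adjoint_works:
  assumes "Vector_Spaces.linear mscale mscale \<Phi>"
  shows "hs_inner (\<Phi> X) Y = hs_inner X (hs_adjoint \<Phi> Y)"
  using theI'[OF hs_adjoint_ex1[OF assms]] unfolding hs_adjoint_def by blast

end

theory Submission
  imports Defs
begin

text \<open>
  Put \<open>r = 1 / (2 - p)\<close> and write \<open>\<Psi>\<close> for the Hilbert--Schmidt adjoint of \<open>\<Phi>\<close>. The power
  \<open>z\<^sup>r\<close> has a variational description: by the weighted inequality between the arithmetic and the
  geometric mean, \<open>z\<^sup>r \<le> r z c\<^sup>p\<^sup>-\<^sup>1 + (1 - r) c\<close> for \<open>z \<ge> 0\<close> and \<open>c > 0\<close>, with equality at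
  \<open>c = z\<^sup>r\<close> if \<open>z > 0\<close>. Averaged over the overlaps \<open>|\<langle>w\<^sub>i, v\<^sub>j\<rangle>|\<^sup>2\<close> of two eigenbases this becomes
  \<open>Tr Z\<^sup>r \<le> r Tr (Z C\<^sup>p\<^sup>-\<^sup>1) + (1 - r) Tr C\<close> for positive definite \<open>C\<close>, with equality at \<open>C = Z\<^sup>r\<close>
  if \<open>Z\<close> is positive definite
  (\<open>trace_mpow_le\<close>, \<open>trace_mpow_attained\<close>). Take the optimal \<open>C\<close> for \<open>Y = B\<^sup>* A\<^sup>-\<^sup>p B\<close> and use
  \<open>\<Psi> C\<close> as a competitor for \<open>Z = (\<Psi> B)\<^sup>* (\<Psi> A)\<^sup>-\<^sup>p (\<Psi> B)\<close>. As \<open>\<Phi>\<close> is unital, \<open>\<Psi>\<close> preserves the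
  trace, so the theorem follows from the monotonicity
  \<open>Tr ((\<Psi> B)\<^sup>* (\<Psi> A)\<^sup>-\<^sup>p (\<Psi> B) (\<Psi> C)\<^sup>p\<^sup>-\<^sup>1) \<le> Tr (B\<^sup>* A\<^sup>-\<^sup>p B C\<^sup>p\<^sup>-\<^sup>1)\<close>, which is \<open>lieb_monotone\<close>.

  By duality of quadratic forms (\<open>weighted_norm_le_adjoint\<close>) this is the same as
  \<open>Tr ((\<Phi> K)\<^sup>* A\<^sup>p (\<Phi> K) C\<^sup>1\<^sup>-\<^sup>p) \<le> Tr (K\<^sup>* (\<Psi> A)\<^sup>p K (\<Psi> C)\<^sup>1\<^sup>-\<^sup>p)\<close> for all \<open>K\<close>. For \<open>p = 0\<close> and
  \<open>p = 1\<close> the last inequality is the Schwarz inequality for \<open>K\<close> and for \<open>K\<^sup>*\<close>, paired with \<open>C\<close> and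
  with \<open>A\<close> (\<open>schwarz_trace_right\<close>, \<open>schwarz_trace_left\<close>). In eigenbases of the four positive
  matrices both sides are weighted square norms of the vector of matrix entries, with weights
  \<open>a\<^sub>i\<^sup>p c\<^sub>j\<^sup>1\<^sup>-\<^sup>p\<close>, and an additive map that contracts for two families of weights
  contracts for their weighted geometric means (\<open>weighted_interpolation\<close>).
\<close>

section \<open>Diagonalization of Hermitian matrices\<close>

lemma matrix_vector_scaleR: "(A::complex^'n^'m) *v (s *\<^sub>R x) = s *\<^sub>R (A *v x)"
  by (simp add: vec_eq_iff matrix_vector_mult_def scaleR_sum_right)

lemma madj_mult: "madj (A ** B) = madj B ** madj A"
  by (simp add: vec_eq_iff madj_def matrix_matrix_mult_def mult.commute)
lemma madj_madj: "madj (madj A) = A"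
  by (simp add: vec_eq_iff madj_def)
lemma madj_mat_1: "madj (mat 1) = mat 1"
  by (simp add: vec_eq_iff madj_def mat_def)
lemma madj_rdiag: "madj (rdiag d) = rdiag d"
  by (simp add: vec_eq_iff madj_def rdiag_def)

lemma cinner_madj: "cinner x (M *v y) = cinner (madj M *v x) y"
proof -
  have "cinner x (M *v y) = (\<Sum>i\<in>UNIV. \<Sum>j\<in>UNIV. cnj (x $ i) * M $ i $ j * y $ j)"
    by (simp add: cinner_def matrix_vector_mult_def sum_distrib_left mult_ac)
  also have "\<dots> = (\<Sum>j\<in>UNIV. \<Sum>i\<in>UNIV. cnj (x $ i) * M $ i $ j * y $ j)"
    by (rule sum.swap)
  also have "\<dots> = cinner (madj M *v x) y"
    by (simp add: cinner_def matrix_vector_mult_def madj_def sum_distrib_left sum_distrib_right mult_ac)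
  finally show ?thesis .
qed

lemma inner_eq_Re_cinner: "x \<bullet> y = Re (cinner x y)"
  by (simp add: inner_vec_def cinner_def inner_complex_def)

lemma cinner_self: "cinner x x = of_real ((norm x)\<^sup>2)"
proof -
  have "cinner x x = (\<Sum>i\<in>UNIV. of_real ((cmod (x $ i))\<^sup>2))"
    unfolding cinner_def by (intro sum.cong refl) (simp only: complex_norm_square mult.commute)
  then show ?thesis by (simp add: norm_vec_def L2_set_def sum_nonneg)
qed

lemma inner_hermitian: "madj A = A \<Longrightarrow> x \<bullet> (A *v y) = (A *v x) \<bullet> y"
  by (simp add: inner_eq_Re_cinner cinner_madj)

lemma quadratic_nonneg_imp_linear_zero:
  fixes a b :: real
  assumes "\<And>s. 0 \<le> 2 * s * a + s\<^sup>2 * b"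
  shows "a = 0"
proof (rule ccontr)
  assume "a \<noteq> 0"
  define k where "k = \<bar>b\<bar> + 1"
  have k: "k > 0" "b < k" by (auto simp: k_def)
  have "2 * (- a / k) * a + (- a / k)\<^sup>2 * b = a\<^sup>2 * (b - 2 * k) / k\<^sup>2"
    using k by (simp add: field_simps power2_eq_square)
  moreover have "a\<^sup>2 * (b - 2 * k) / k\<^sup>2 < 0"
    using k \<open>a \<noteq> 0\<close> by (auto simp: divide_less_0_iff mult_less_0_iff)
  ultimately show False using assms[of "- a / k"] by simp
qed

text \<open>
  A matrix with the vectors \<open>v i\<close>, \<open>i \<in> I\<close>, as conjugated rows and at least one zero row is
  singular; a kernel vector is orthogonal to all of them.
\<close>

lemma exists_nonzero_orthogonal:
  fixes v :: "'n \<Rightarrow> complex^'n"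
  assumes "I \<noteq> UNIV"
  shows "\<exists>x. x \<noteq> 0 \<and> (\<forall>i\<in>I. cinner (v i) x = 0)"
proof -
  define M :: "complex^'n^'n" where "M = (\<chi> i j. if i \<in> I then cnj (v i $ j) else 0)"
  obtain k where "k \<notin> I" using assms by auto
  then have "row k M = 0" by (simp add: row_def M_def vec_eq_iff)
  then have "det M = 0" by (rule det_zero_row)
  then have "\<not> (\<exists>B. B ** M = mat 1)"
    by (metis invertible_det_nz invertible_left_inverse)
  then obtain x where x: "M *v x = 0" "x \<noteq> 0"
    by (auto simp: matrix_left_invertible_ker)
  have "cinner (v i) x = 0" if "i \<in> I" for i
  proof -
    have "cinner (v i) x = (M *v x) $ i"
      using that by (simp add: M_def cinner_def matrix_vector_mult_def)
    then show ?thesis by (simp add: x)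
  qed
  with x(2) show ?thesis by blast
qed

text \<open>
  The orthogonal complement of given eigenvectors is invariant under \<open>A\<close>, so a maximizer of the
  Rayleigh quotient over its unit sphere is a further eigenvector. Real variations of the
  maximizer suffice, so the argument uses \<open>\<bullet>\<close>, the real part of \<open>cinner\<close>.
\<close>

lemma hermitian_eigenvector_orthogonal:
  fixes A :: "complex^'n^'n" and v :: "'n \<Rightarrow> complex^'n"
  assumes A: "madj A = A" and I: "I \<noteq> UNIV"
    and ev: "\<And>i. i \<in> I \<Longrightarrow> A *v v i = d i *\<^sub>R v i"
  obtains x l where "norm x = 1" "\<And>i. i \<in> I \<Longrightarrow> cinner (v i) x = 0" "A *v x = l *\<^sub>R x"
proof -
  define W where "W = {x. \<forall>i\<in>I. cinner (v i) x = 0}"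
  have W_add: "x + y \<in> W" "x - y \<in> W" if "x \<in> W" "y \<in> W" for x y
    using that by (auto simp: W_def cinner_def algebra_simps sum.distrib sum_subtractf)
  have W_scale: "s *\<^sub>R x \<in> W" if "x \<in> W" for x s
  proof -
    have "cinner u (s *\<^sub>R x) = s *\<^sub>R cinner u x" for u
      by (simp add: cinner_def scaleR_sum_right)
    with that show ?thesis by (simp add: W_def)
  qed
  have W_A: "A *v x \<in> W" if "x \<in> W" for x
  proof -
    have "cinner (v i) (A *v x) = d i *\<^sub>R cinner (v i) x" if "i \<in> I" for i
      using that by (simp add: cinner_madj A ev) (simp add: cinner_def scaleR_sum_right)
    with that show ?thesis by (simp add: W_def)
  qed
  define S where "S = sphere 0 1 \<inter> W"
  have "closed W"
  proof -
    have "W = (\<Inter>i\<in>I. {x. cinner (v i) x = 0})" by (auto simp: W_def)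
    moreover have "closed {x. cinner (v i) x = 0}" for i
      unfolding cinner_def by (intro closed_Collect_eq continuous_intros)
    ultimately show ?thesis by auto
  qed
  then have "compact S" by (simp add: S_def compact_Int_closed)
  moreover have "S \<noteq> {}"
  proof -
    obtain x where "x \<noteq> 0" and "\<forall>i\<in>I. cinner (v i) x = 0"
      using exists_nonzero_orthogonal[OF I] by blast
    moreover from this have "x \<in> W" by (simp add: W_def)
    ultimately have "(1 / norm x) *\<^sub>R x \<in> S" by (simp add: S_def W_scale)
    then show ?thesis by auto
  qed
  moreover have "continuous_on S (\<lambda>x. x \<bullet> (A *v x))"
    unfolding inner_eq_Re_cinner cinner_def matrix_vector_mult_def
    by (intro continuous_intros)
  ultimately obtain x where x: "x \<in> S" and max: "\<And>z. z \<in> S \<Longrightarrow> z \<bullet> (A *v z) \<le> x \<bullet> (A *v x)"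
    using continuous_attains_sup[of S "\<lambda>x. x \<bullet> (A *v x)"] by blast
  define l where "l = x \<bullet> (A *v x)"
  have xW: "x \<in> W" and nx: "norm x = 1" using x by (auto simp: S_def)
  have Q: "z \<bullet> (A *v z) \<le> l * (z \<bullet> z)" if "z \<in> W" for z
  proof (cases "z = 0")
    case False
    then have "(1 / norm z) *\<^sub>R z \<in> S" using that by (simp add: S_def W_scale)
    from max[OF this] False show ?thesis
      by (simp add: matrix_vector_scaleR l_def[symmetric] divide_simps
          power2_norm_eq_inner[symmetric] power2_eq_square mult.commute split: if_splits)
  qed simp
  define y where "y = l *\<^sub>R x - A *v x"
  have yW: "y \<in> W" unfolding y_def by (intro W_add W_scale W_A xW)
  \<comment> \<open>The form \<open>l (z \<bullet> z) - z \<bullet> A z\<close> is nonnegative on \<open>W\<close> and vanishes at \<open>x\<close>, so its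
      first variation at \<open>x\<close> in the direction \<open>y\<close>, which is \<open>2 (y \<bullet> y)\<close>, is zero.\<close>
  have "y \<bullet> y = 0"
  proof (rule quadratic_nonneg_imp_linear_zero)
    fix s :: real
    have "x \<bullet> (A *v y) = y \<bullet> (A *v x)"
      using inner_hermitian[OF A] by (simp add: inner_commute)
    moreover have "y \<bullet> y = l * (x \<bullet> y) - y \<bullet> (A *v x)"
      by (subst (2) y_def) (simp add: inner_diff_right inner_commute)
    moreover have "x \<bullet> x = 1" using nx by (simp add: dot_square_norm)
    ultimately have "l * ((x + s *\<^sub>R y) \<bullet> (x + s *\<^sub>R y)) - (x + s *\<^sub>R y) \<bullet> (A *v (x + s *\<^sub>R y))
        = 2 * s * (y \<bullet> y) + s\<^sup>2 * (l * (y \<bullet> y) - y \<bullet> (A *v y))"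
      by (simp add: matrix_vector_right_distrib matrix_vector_scaleR inner_add_left inner_add_right
          l_def[symmetric] inner_commute[of y x] power2_eq_square) (simp add: algebra_simps)
    with Q[of "x + s *\<^sub>R y"] show "0 \<le> 2 * s * (y \<bullet> y) + s\<^sup>2 * (l * (y \<bullet> y) - y \<bullet> (A *v y))"
      using W_add W_scale xW yW by auto
  qed
  then have "A *v x = l *\<^sub>R x" by (simp add: y_def)
  with nx xW show ?thesis using that by (auto simp: W_def)
qed

text \<open>
  Orthonormal eigenvectors are collected one index at a time until every index in \<open>'n\<close> carries one;
  they are the columns of \<open>U\<close>.
\<close>

theorem hermitian_diagonalization:
  fixes A :: "complex^'n^'n"
  assumes A: "madj A = A"
  obtains U d where "unitary U" "A = U ** rdiag d ** madj U"
proof -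
  have "\<exists>(v::'n \<Rightarrow> complex^'n) d. (\<forall>i\<in>I. \<forall>j\<in>I. cinner (v i) (v j) = (if i = j then 1 else 0)) \<and>
          (\<forall>i\<in>I. A *v v i = d i *\<^sub>R v i)" for I :: "'n set"
    using finite[of I]
  proof (induction I rule: finite_induct)
    case (insert k I)
    then obtain v d where v: "\<And>i j. i\<in>I \<Longrightarrow> j\<in>I \<Longrightarrow> cinner (v i) (v j) = (if i = j then 1 else 0)"
      and d: "\<And>i. i\<in>I \<Longrightarrow> A *v v i = d i *\<^sub>R v i" by metis
    have "I \<noteq> UNIV" using insert by auto
    then obtain x l where x: "norm x = 1" "\<And>i. i \<in> I \<Longrightarrow> cinner (v i) x = 0" "A *v x = l *\<^sub>R x"
      using hermitian_eigenvector_orthogonal[OF A, of I v d] d by blast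
    have "cinner x (v i) = 0" if "i \<in> I" for i
    proof -
      have "cinner x (v i) = cnj (cinner (v i) x)" by (simp add: cinner_def mult.commute)
      with x(2)[OF that] show ?thesis by simp
    qed
    moreover have "cinner x x = 1" by (simp add: cinner_self x)
    ultimately show ?case
      using insert x v d
      by (intro exI[of _ "v(k := x)"] exI[of _ "d(k := l)"]) auto
  qed simp
  then obtain v :: "'n \<Rightarrow> complex^'n" and d
    where v: "\<And>i j. cinner (v i) (v j) = (if i = j then 1 else 0)"
      and d: "\<And>i. A *v v i = d i *\<^sub>R v i"
    by (metis UNIV_I)
  define U :: "complex^'n^'n" where "U = (\<chi> i j. v j $ i)"
  have UU: "madj U ** U = mat 1"
    using v by (simp add: vec_eq_iff U_def madj_def matrix_matrix_mult_def mat_def cinner_def)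
  then have U: "unitary U" by (simp add: unitary_def matrix_left_right_inverse)
  have "A ** U = U ** rdiag d"
  proof -
    have "(A ** U) $ i $ j = U $ i $ j * of_real (d j)" for i j
    proof -
      have "(A ** U) $ i $ j = (A *v v j) $ i"
        by (simp add: U_def matrix_matrix_mult_def matrix_vector_mult_def)
      also have "\<dots> = d j *\<^sub>R (v j $ i)"
        by (simp add: d)
      finally show ?thesis
        by (simp add: U_def scaleR_conv_of_real mult.commute)
    qed
    then show ?thesis
      by (simp add: vec_eq_iff rdiag_mult_right)
  qed
  then have "A = U ** rdiag d ** madj U"
    using U by (metis matrix_mul_assoc matrix_mul_rid unitary_def)
  with U show ?thesis using that by blast
qed

section \<open>Interpolation between weighted square norms\<close>

text \<open>
  This exponential tail, reflected as well, dominates the integrand in the representation of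
  weighted geometric means below.
\<close>

lemma integrable_exp_atLeast_0:
  fixes q :: real
  assumes "0 < q"
  shows "integrable lborel (\<lambda>s. indicator {0..} s * exp (- q * s))"
proof (rule integrableI_nonneg)
  have "(\<integral>\<^sup>+ s. ennreal (exp (- q * s)) * indicator {0..} s \<partial>lborel) = ennreal (0 - (- exp (- q * 0) / q))"
  proof (rule nn_integral_FTC_atLeast)
    fix s :: real
    show "((\<lambda>s. - exp (- q * s) / q) has_real_derivative exp (- q * s)) (at s)"
      using assms by (auto intro!: derivative_eq_intros)
  next
    have "((\<lambda>s. exp (- q * s)) \<longlongrightarrow> 0) at_top"
      using assms
      by (intro filterlim_compose[OF exp_at_bot] filterlim_tendsto_neg_mult_at_bot[OF tendsto_const])
         (auto simp: filterlim_ident)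
    from tendsto_divide[OF tendsto_minus[OF this] tendsto_const, of q]
    show "((\<lambda>s. - exp (- q * s) / q) \<longlongrightarrow> 0) at_top"
      using assms by simp
  qed auto
  also have "\<dots> < \<infinity>" by simp
  finally have fin: "(\<integral>\<^sup>+ s. ennreal (exp (- q * s)) * indicator {0..} s \<partial>lborel) < \<infinity>" .
  show "(\<integral>\<^sup>+ s. ennreal (indicator {0..} s * exp (- q * s)) \<partial>lborel) < \<infinity>"
  proof -
    have "ennreal (indicator {0..} s * exp (- q * s)) = ennreal (exp (- q * s)) * indicator {0..} s" for s
      by (simp add: indicator_def)
    then show ?thesis using fin by (simp only:)
  qed
qed auto

text \<open>
  The weighted geometric mean \<open>a\<^sup>p b\<^sup>1\<^sup>-\<^sup>p\<close> is, up to a constant, an integral over \<open>s\<close> of the parallel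
  sums \<open>a e\<^sup>s b / (a + e\<^sup>s b)\<close> with positive weights. In the logarithmic parameter \<open>s\<close> the ratio \<open>a / b\<close>
  enters only as a translation, so one constant \<open>c\<close> serves for all \<open>a\<close> and \<open>b\<close>.
\<close>

lemma powr_mult_powr_integral:
  fixes p :: real
  assumes "0 < p" "p < 1"
  obtains c where "0 < c" "\<And>a b. 0 < a \<Longrightarrow> 0 < b \<Longrightarrow>
     has_bochner_integral lborel (\<lambda>s. exp (p * s) * (a * b / (a + exp s * b)))
       (c * (a powr p * b powr (1 - p)))"
proof -
  define f where "f s = exp (p * s) / (1 + exp s)" for s :: real
  have f_pos: "0 < f s" for s by (simp add: f_def add_pos_pos)
  have f_meas: "f \<in> borel_measurable lborel" unfolding f_def by measurable
  have f_int: "integrable lborel f"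
  proof (rule Bochner_Integration.integrable_bound)
    have "integrable lborel (\<lambda>s. indicator {0..} (0 + (-1) * s) * exp (- p * (0 + (-1) * s)))"
      by (subst lborel_integrable_real_affine_iff) (use integrable_exp_atLeast_0[of p] assms in simp_all)
    then show "integrable lborel (\<lambda>s. indicator {0..} (0 + (-1) * s) * exp (- p * (0 + (-1) * s)) +
        indicator {0..} s * exp (- (1 - p) * s))"
      using assms by (intro Bochner_Integration.integrable_add integrable_exp_atLeast_0) auto
    have "f s \<le> exp (p * s)" for s
      by (simp add: f_def divide_le_eq add_pos_pos)
    moreover have "f s \<le> exp (- (1 - p) * s)" for s
    proof -
      have "exp (p * s) = exp (- (1 - p) * s) * exp s"
        by (simp add: exp_add[symmetric] algebra_simps)
      then show ?thesis by (simp add: f_def divide_le_eq add_pos_pos)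
    qed
    moreover have "f 0 \<le> 2" by (simp add: f_def)
    ultimately have "f s \<le> indicator {0..} (0 + (-1) * s) * exp (- p * (0 + (-1) * s)) +
        indicator {0..} s * exp (- (1 - p) * s)" for s
      by (cases s "0 :: real" rule: linorder_cases) (auto simp: add_increasing)
    then have "norm (f s) \<le> norm (indicator {0..} (0 + (-1) * s) * exp (- p * (0 + (-1) * s)) +
        indicator {0..} s * exp (- (1 - p) * s))" for s
      using f_pos[of s] by (metis abs_ge_self abs_of_pos order_trans real_norm_def)
    then show "AE s in lborel. norm (f s) \<le> norm (indicator {0..} (0 + (-1) * s) * exp (- p * (0 + (-1) * s)) +
        indicator {0..} s * exp (- (1 - p) * s))"
      by (rule AE_I2)
  qed (fact f_meas)
  show ?thesis
  proof (rule that)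
    show "0 < integral\<^sup>L lborel f"
    proof -
      have "\<not> (AE s::real in lborel. f s = 0)"
      proof
        assume "AE s::real in lborel. f s = 0"
        then have "AE s::real in lborel. False"
          by (rule eventually_mono) (metis f_pos less_irrefl)
        then show False by (simp add: AE_iff_null null_sets_def)
      qed
      then have "integral\<^sup>L lborel f \<noteq> 0"
        using f_pos by (subst integral_nonneg_eq_0_iff_AE[OF f_int]) (simp_all add: less_imp_le)
      moreover have "0 \<le> integral\<^sup>L lborel f" using f_pos by (simp add: less_imp_le)
      ultimately show ?thesis by simp
    qed
    fix a b :: real assume ab: "0 < a" "0 < b"
    \<comment> \<open>The factor 1 in front of \<open>s\<close> makes this an instance of the affine substitution rule.\<close>
    have "has_bochner_integral lborel (\<lambda>s. f ((ln b - ln a) + 1 * s)) (integral\<^sup>L lborel f)"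
      using lborel_has_bochner_integral_real_affine_iff[of 1 f "integral\<^sup>L lborel f" "ln b - ln a"] f_int
      by (simp add: has_bochner_integral_integrable)
    from has_bochner_integral_mult_right[OF this, of "a powr p * b powr (1 - p)"]
    have "has_bochner_integral lborel (\<lambda>s. a powr p * b powr (1 - p) * f ((ln b - ln a) + 1 * s))
        (integral\<^sup>L lborel f * (a powr p * b powr (1 - p)))"
      by (simp add: mult.commute)
    moreover have "a powr p * b powr (1 - p) * f ((ln b - ln a) + 1 * s)
        = exp (p * s) * (a * b / (a + exp s * b))" for s
    proof -
      have "exp (p * ((ln b - ln a) + s)) = exp (p * s) * b powr p / a powr p"
        using ab by (simp add: powr_def exp_add exp_diff algebra_simps)
      moreover have "exp ((ln b - ln a) + s) = exp s * b / a"
        using ab by (simp add: exp_add exp_diff)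
      ultimately have "f ((ln b - ln a) + 1 * s) = exp (p * s) * b powr p / a powr p / (1 + exp s * b / a)"
        by (simp add: f_def)
      moreover have "b = b powr p * b powr (1 - p)" using ab by (simp flip: powr_add)
      moreover have "u * q * (e * v / u / (1 + x / a)) = e * (a * (v * q) / (a + x))"
        if "0 < u" "0 < x" for u q e v x :: real
        using that ab by (simp add: divide_simps add_pos_pos less_imp_neq[symmetric])
      ultimately show ?thesis using ab by simp
    qed
    ultimately show "has_bochner_integral lborel (\<lambda>s. exp (p * s) * (a * b / (a + exp s * b)))
       (integral\<^sup>L lborel f * (a powr p * b powr (1 - p)))" by simp
  qed
qed

text \<open>
  The parallel sum \<open>a b / (a + b)\<close> is characterized by
  \<open>|z|\<^sup>2 a b / (a + b) = min {a |x|\<^sup>2 + b |y|\<^sup>2 | x + y = z}\<close>. This lemma is the lower bound, the next one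
  the optimal decomposition.
\<close>

lemma parallel_sum_le:
  fixes a b :: real and x y :: complex
  assumes "0 < a" "0 < b"
  shows "(cmod (x + y))\<^sup>2 * (a * b / (a + b)) \<le> a * (cmod x)\<^sup>2 + b * (cmod y)\<^sup>2"
proof -
  have "(cmod (x + y))\<^sup>2 \<le> (cmod x + cmod y)\<^sup>2"
    by (simp add: norm_triangle_ineq power_mono)
  moreover have "(cmod x + cmod y)\<^sup>2 * (a * b) \<le> (a * (cmod x)\<^sup>2 + b * (cmod y)\<^sup>2) * (a + b)"
  proof -
    have "(a * (cmod x)\<^sup>2 + b * (cmod y)\<^sup>2) * (a + b) - (cmod x + cmod y)\<^sup>2 * (a * b)
        = (a * cmod x - b * cmod y)\<^sup>2" by (simp add: power2_eq_square algebra_simps)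
    then show ?thesis by (metis diff_ge_0_iff_ge zero_le_power2)
  qed
  ultimately have "(cmod (x + y))\<^sup>2 * (a * b) \<le> (a * (cmod x)\<^sup>2 + b * (cmod y)\<^sup>2) * (a + b)"
    using assms by (meson mult_pos_pos mult_right_mono less_imp_le order_trans)
  then show ?thesis using assms by (simp add: pos_divide_le_eq)
qed

lemma parallel_sum_eq:
  fixes a b :: real and x :: complex
  assumes "0 < a" "0 < b"
  shows "a * (cmod (of_real (b / (a + b)) * x))\<^sup>2 + b * (cmod (of_real (a / (a + b)) * x))\<^sup>2
     = (cmod x)\<^sup>2 * (a * b / (a + b))"
proof -
  have *: "a + b \<noteq> 0" using assms by simp
  have "a * (b / (a + b))\<^sup>2 + b * (a / (a + b))\<^sup>2 = a * b * (a + b) / (a + b)\<^sup>2"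
    by (simp add: power_divide power2_eq_square add_divide_distrib algebra_simps)
  also have "\<dots> = a * b / (a + b)" using * by (simp add: power2_eq_square)
  finally have "a * (b / (a + b))\<^sup>2 + b * (a / (a + b))\<^sup>2 = a * b / (a + b)" .
  from arg_cong[OF this, of "\<lambda>z. (cmod x)\<^sup>2 * z"] show ?thesis
    by (simp only: norm_mult norm_of_real power_mult_distrib power2_abs) (simp only: algebra_simps)
qed

text \<open>
  Interpolation between weighted \<open>\<ell>\<^sup>2\<close> norms. A minimum over decompositions \<open>x = y + z\<close> is compatible
  with an additive map \<open>T\<close>: applying \<open>T\<close> to the optimal decomposition of \<open>x\<close> gives a decomposition
  of \<open>T x\<close>, so the two hypotheses give the claim for all parallel sums of the weights \<open>a\<close> and
  \<open>t b\<close>. Integrating over \<open>s\<close> with \<open>t = e\<^sup>s\<close> gives the weighted geometric mean.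
\<close>

lemma weighted_interpolation:
  fixes T :: "('i::finite \<Rightarrow> complex) \<Rightarrow> 'j::finite \<Rightarrow> complex"
    and a b :: "'i \<Rightarrow> real" and a' b' :: "'j \<Rightarrow> real"
  assumes add: "\<And>x y. T (\<lambda>i. x i + y i) = (\<lambda>j. T x j + T y j)"
    and pos: "\<And>i. 0 < a i" "\<And>i. 0 < b i" "\<And>j. 0 < a' j" "\<And>j. 0 < b' j"
    and a: "\<And>x. (\<Sum>j\<in>UNIV. (cmod (T x j))\<^sup>2 * a' j) \<le> (\<Sum>i\<in>UNIV. (cmod (x i))\<^sup>2 * a i)"
    and b: "\<And>x. (\<Sum>j\<in>UNIV. (cmod (T x j))\<^sup>2 * b' j) \<le> (\<Sum>i\<in>UNIV. (cmod (x i))\<^sup>2 * b i)"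
    and p: "0 < p" "p < 1"
  shows "(\<Sum>j\<in>UNIV. (cmod (T x j))\<^sup>2 * (a' j powr p * b' j powr (1 - p)))
       \<le> (\<Sum>i\<in>UNIV. (cmod (x i))\<^sup>2 * (a i powr p * b i powr (1 - p)))"
proof -
  have par: "(\<Sum>j\<in>UNIV. (cmod (T x j))\<^sup>2 * (a' j * b' j / (a' j + t * b' j)))
       \<le> (\<Sum>i\<in>UNIV. (cmod (x i))\<^sup>2 * (a i * b i / (a i + t * b i)))" if t: "0 < t" for t :: real
  proof -
    have scale: "z * (u * (t * v) / (u + t * v)) = t * (z * (u * v / (u + t * v)))" for z u v :: real
      by simp
    \<comment> \<open>The optimal decomposition of \<open>x\<close> for the weights \<open>a\<close> and \<open>t b\<close>.\<close>
    define y where "y i = of_real (t * b i / (a i + t * b i)) * x i" for i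
    define z where "z i = of_real (a i / (a i + t * b i)) * x i" for i
    have "of_real (t * b i / (a i + t * b i)) + of_real (a i / (a i + t * b i)) = (1 :: complex)" for i
    proof -
      have "a i + t * b i > 0" using pos t by (simp add: add_pos_pos)
      then have "t * b i / (a i + t * b i) + a i / (a i + t * b i) = 1"
        by (simp add: add_divide_distrib[symmetric] add.commute)
      then show ?thesis by (metis of_real_1 of_real_add)
    qed
    then have x: "x = (\<lambda>i. y i + z i)"
      unfolding y_def z_def by (simp only: distrib_right[symmetric] mult_1_left)
    have "t * (\<Sum>j\<in>UNIV. (cmod (T x j))\<^sup>2 * (a' j * b' j / (a' j + t * b' j)))
        = (\<Sum>j\<in>UNIV. (cmod (T y j + T z j))\<^sup>2 * (a' j * (t * b' j) / (a' j + t * b' j)))"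
      unfolding scale by (subst x, subst add) (simp add: sum_distrib_left)
    also have "\<dots> \<le> (\<Sum>j\<in>UNIV. a' j * (cmod (T y j))\<^sup>2 + (t * b' j) * (cmod (T z j))\<^sup>2)"
      by (intro sum_mono parallel_sum_le) (use pos t in auto)
    also have "\<dots> = (\<Sum>j\<in>UNIV. (cmod (T y j))\<^sup>2 * a' j) + t * (\<Sum>j\<in>UNIV. (cmod (T z j))\<^sup>2 * b' j)"
      by (simp add: sum.distrib sum_distrib_left algebra_simps)
    also have "\<dots> \<le> (\<Sum>i\<in>UNIV. (cmod (y i))\<^sup>2 * a i) + t * (\<Sum>i\<in>UNIV. (cmod (z i))\<^sup>2 * b i)"
      using t by (intro add_mono a mult_left_mono b) auto
    also have "\<dots> = (\<Sum>i\<in>UNIV. a i * (cmod (y i))\<^sup>2 + (t * b i) * (cmod (z i))\<^sup>2)"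
      by (simp add: sum.distrib sum_distrib_left algebra_simps)
    also have "\<dots> = (\<Sum>i\<in>UNIV. (cmod (x i))\<^sup>2 * (a i * (t * b i) / (a i + t * b i)))"
      unfolding y_def z_def by (intro sum.cong refl parallel_sum_eq) (use pos t in auto)
    also have "\<dots> = t * (\<Sum>i\<in>UNIV. (cmod (x i))\<^sup>2 * (a i * b i / (a i + t * b i)))"
      unfolding scale by (simp add: sum_distrib_left)
    finally show ?thesis using t by simp
  qed
  obtain c where c: "0 < c" and int: "\<And>a b. 0 < a \<Longrightarrow> 0 < b \<Longrightarrow>
     has_bochner_integral lborel (\<lambda>s. exp (p * s) * (a * b / (a + exp s * b)))
       (c * (a powr p * b powr (1 - p)))"
    using powr_mult_powr_integral[OF p] by blast
  have int_sum: "has_bochner_integral lborel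
      (\<lambda>s. exp (p * s) * (\<Sum>k\<in>UNIV. (cmod (w k))\<^sup>2 * (u k * v k / (u k + exp s * v k))))
      (c * (\<Sum>k\<in>UNIV. (cmod (w k))\<^sup>2 * (u k powr p * v k powr (1 - p))))"
    if "\<And>k. 0 < u k" "\<And>k. 0 < v k" for w :: "'k::finite \<Rightarrow> complex" and u v
  proof -
    have "has_bochner_integral lborel
      (\<lambda>s. \<Sum>k\<in>UNIV. (cmod (w k))\<^sup>2 * (exp (p * s) * (u k * v k / (u k + exp s * v k))))
      (\<Sum>k\<in>UNIV. (cmod (w k))\<^sup>2 * (c * (u k powr p * v k powr (1 - p))))"
      by (intro has_bochner_integral_sum has_bochner_integral_mult_right int that)
    then show ?thesis by (simp add: sum_distrib_left mult_ac)
  qed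
  note L = int_sum[of a' b' "T x", OF pos(3,4)] and R = int_sum[of a b x, OF pos(1,2)]
  have "c * (\<Sum>j\<in>UNIV. (cmod (T x j))\<^sup>2 * (a' j powr p * b' j powr (1 - p)))
      \<le> c * (\<Sum>i\<in>UNIV. (cmod (x i))\<^sup>2 * (a i powr p * b i powr (1 - p)))"
    unfolding has_bochner_integral_integral_eq[OF L, symmetric]
      has_bochner_integral_integral_eq[OF R, symmetric]
  proof (rule integral_mono[OF integrable.intros[OF L] integrable.intros[OF R]])
    fix s :: real
    show "exp (p * s) * (\<Sum>j\<in>UNIV. (cmod (T x j))\<^sup>2 * (a' j * b' j / (a' j + exp s * b' j)))
        \<le> exp (p * s) * (\<Sum>i\<in>UNIV. (cmod (x i))\<^sup>2 * (a i * b i / (a i + exp s * b i)))"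
      using par[of "exp s"] by (intro mult_left_mono) simp_all
  qed
  with c show ?thesis by simp
qed

text \<open>
  The adjoint of a contraction is a contraction for the inverse weights. With \<open>z\<close> the image of \<open>y\<close>
  under the adjoint of \<open>T\<close>, the dual norm of \<open>z\<close> is attained at \<open>x = z / w\<close>, and
  \<open>2 Re \<langle>T x, y\<rangle> \<le> \<Sum> |T x|\<^sup>2 w' + \<Sum> |y|\<^sup>2 / w'\<close> turns the bound for \<open>T\<close> at this \<open>x\<close> into the
  claim.
\<close>

lemma weighted_norm_le_adjoint:
  fixes T :: "('i::finite \<Rightarrow> complex) \<Rightarrow> 'j::finite \<Rightarrow> complex"
    and w :: "'i \<Rightarrow> real" and w' :: "'j \<Rightarrow> real"
  assumes pos: "\<And>i. 0 < w i" "\<And>j. 0 < w' j"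
    and le: "\<And>x. (\<Sum>j\<in>UNIV. (cmod (T x j))\<^sup>2 * w' j) \<le> (\<Sum>i\<in>UNIV. (cmod (x i))\<^sup>2 * w i)"
    and adj: "\<And>x. (\<Sum>j\<in>UNIV. cnj (T x j) * y j) = (\<Sum>i\<in>UNIV. cnj (x i) * z i)"
  shows "(\<Sum>i\<in>UNIV. (cmod (z i))\<^sup>2 / w i) \<le> (\<Sum>j\<in>UNIV. (cmod (y j))\<^sup>2 / w' j)"
proof -
  define x where "x i = z i / of_real (w i)" for i
  have "(\<Sum>i\<in>UNIV. cnj (x i) * z i) = of_real (\<Sum>i\<in>UNIV. (cmod (z i))\<^sup>2 / w i)"
    by (simp add: x_def complex_norm_square mult.commute del: of_real_power)
  then have *: "(\<Sum>i\<in>UNIV. (cmod (z i))\<^sup>2 / w i) = Re (\<Sum>j\<in>UNIV. cnj (T x j) * y j)"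
    by (simp only: adj Re_complex_of_real)
  have young: "2 * Re (cnj s * t) \<le> (cmod s)\<^sup>2 * r + (cmod t)\<^sup>2 / r" if "0 < r" for s t and r :: real
  proof -
    have "2 * Re (cnj s * t) \<le> 2 * (cmod s * cmod t)"
      using complex_Re_le_cmod[of "cnj s * t"] by (simp add: norm_mult)
    also have "\<dots> \<le> (cmod s)\<^sup>2 * r + (cmod t)\<^sup>2 / r"
    proof -
      have "(cmod s)\<^sup>2 * r + (cmod t)\<^sup>2 / r - 2 * (cmod s * cmod t) = (cmod s * r - cmod t)\<^sup>2 / r"
        using that by (simp add: power2_eq_square field_simps)
      moreover have "0 \<le> (cmod s * r - cmod t)\<^sup>2 / r" using that by simp
      ultimately show ?thesis by simp
    qed
    finally show ?thesis .
  qed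
  have "2 * (\<Sum>i\<in>UNIV. (cmod (z i))\<^sup>2 / w i) = (\<Sum>j\<in>UNIV. 2 * Re (cnj (T x j) * y j))"
    unfolding * by (simp add: sum_distrib_left)
  also have "\<dots> \<le> (\<Sum>j\<in>UNIV. (cmod (T x j))\<^sup>2 * w' j + (cmod (y j))\<^sup>2 / w' j)"
    by (intro sum_mono young pos)
  also have "\<dots> \<le> (\<Sum>i\<in>UNIV. (cmod (x i))\<^sup>2 * w i) + (\<Sum>j\<in>UNIV. (cmod (y j))\<^sup>2 / w' j)"
    using le[of x] by (simp add: sum.distrib)
  also have "(\<Sum>i\<in>UNIV. (cmod (x i))\<^sup>2 * w i) = (\<Sum>i\<in>UNIV. (cmod (z i))\<^sup>2 / w i)"
    using pos(1) by (intro sum.cong refl)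
      (simp add: x_def norm_divide power_divide power2_eq_square less_imp_le abs_of_pos less_imp_neq[symmetric])
  finally show ?thesis by simp
qed

section \<open>Positive matrices and traces in eigenbases\<close>

lemma complex_of_real_le_iff: "complex_of_real x \<le> complex_of_real y \<longleftrightarrow> x \<le> y"
  by (simp add: less_eq_complex_def)

lemma complex_of_real_nonneg_iff: "0 \<le> complex_of_real x \<longleftrightarrow> 0 \<le> x"
  by (simp add: less_eq_complex_def)

lemma complex_of_real_pos_iff: "0 < complex_of_real x \<longleftrightarrow> 0 < x"
  by (simp add: less_complex_def)

lemma rdiag_1: "rdiag (\<lambda>_. 1) = (mat 1 :: complex^'n^'n)"
  by (simp add: vec_eq_iff rdiag_def mat_def)

lemma rdiag_mult: "rdiag d ** rdiag e = rdiag (\<lambda>i. d i * e i)"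
  by (simp add: vec_eq_iff rdiag_mult_left) (simp add: rdiag_def)

lemma unitary_mult_cancel:
  assumes "unitary U"
  shows "madj U ** U = mat 1" "U ** madj U = mat 1"
    "M ** madj U ** U = M" "M ** U ** madj U = M" "madj U ** (U ** M) = M" "U ** (madj U ** M) = M"
  using assms by (auto simp: unitary_def matrix_mul_assoc) (auto simp: matrix_mul_assoc[symmetric])

lemma rdiag_conj_mult:
  assumes "unitary U"
  shows "(U ** rdiag d ** madj U) ** (U ** rdiag e ** madj U) = U ** rdiag (\<lambda>i. d i * e i) ** madj U"
  by (simp add: matrix_mul_assoc[symmetric] unitary_mult_cancel[OF assms])
     (simp add: matrix_mul_assoc rdiag_mult[symmetric])

text \<open>
  The reason for working in eigenbases: for Hermitian matrices in diagonalized form the trace is a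
  weighted square norm of the entries of \<open>K\<close>, written in the two bases.
\<close>

lemma trace_weighted:
  fixes K U V :: "complex^'n^'n"
  shows "trace (madj K ** (U ** rdiag a ** madj U) ** K ** (V ** rdiag c ** madj V))
     = of_real (\<Sum>i\<in>UNIV. \<Sum>j\<in>UNIV. (cmod ((madj U ** K ** V) $ i $ j))\<^sup>2 * (a i * c j))"
proof -
  define W where "W = madj U ** K ** V"
  have W: "madj W = madj V ** madj K ** U"
    by (simp add: W_def madj_mult madj_madj matrix_mul_assoc)
  have "trace (madj K ** (U ** rdiag a ** madj U) ** K ** (V ** rdiag c ** madj V))
      = trace ((madj K ** (U ** rdiag a ** madj U) ** K ** V ** rdiag c) ** madj V)"
    by (simp add: matrix_mul_assoc)
  also have "\<dots> = trace (madj V ** (madj K ** (U ** rdiag a ** madj U) ** K ** V ** rdiag c))"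
    by (rule trace_mul_sym)
  also have "\<dots> = trace (madj W ** (rdiag a ** W) ** rdiag c)"
    by (simp add: W) (simp add: W_def matrix_mul_assoc)
  also have "\<dots> = (\<Sum>j\<in>UNIV. \<Sum>i\<in>UNIV. of_real ((cmod (W $ i $ j))\<^sup>2 * (a i * c j)))"
    unfolding trace_def rdiag_mult_right
    unfolding matrix_matrix_mult_def[of "madj W"]
    by (simp add: rdiag_mult_left sum_distrib_left sum_distrib_right madj_def
        complex_norm_square mult_ac del: of_real_power)
  also have "\<dots> = of_real (\<Sum>i\<in>UNIV. \<Sum>j\<in>UNIV. (cmod (W $ i $ j))\<^sup>2 * (a i * c j))"
    by (subst sum.swap) simp
  finally show ?thesis by (simp add: W_def)
qed

lemma trace_rdiag_conj_mult:
  fixes V W :: "complex^'n^'n"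
  shows "trace ((W ** rdiag z ** madj W) ** (V ** rdiag c ** madj V))
     = of_real (\<Sum>i\<in>UNIV. \<Sum>j\<in>UNIV. (cmod ((madj W ** V) $ i $ j))\<^sup>2 * (z i * c j))"
  using trace_weighted[of "mat 1" W z V c] by (simp add: madj_mat_1)

lemma cinner_rdiag_conj:
  fixes U :: "complex^'n^'n"
  shows "cinner x ((U ** rdiag d ** madj U) *v x) = of_real (\<Sum>i\<in>UNIV. d i * (cmod ((madj U *v x) $ i))\<^sup>2)"
proof -
  define y where "y = madj U *v x"
  have D: "(rdiag d *v y) $ i = of_real (d i) * y $ i" for i
    by (simp add: rdiag_def matrix_vector_mult_def if_distrib[of "\<lambda>z. z * _"] cong: if_cong)
  have "cinner x ((U ** rdiag d ** madj U) *v x) = cinner y (rdiag d *v y)"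
    by (simp add: matrix_vector_mul_assoc[symmetric] cinner_madj[of x U] y_def)
  also have "\<dots> = of_real (\<Sum>i\<in>UNIV. d i * (cmod (y $ i))\<^sup>2)"
    by (simp add: cinner_def D complex_norm_square mult_ac del: of_real_power)
  finally show ?thesis by (simp add: y_def)
qed

lemma madj_rdiag_conj:
  fixes U :: "complex^'n^'n"
  shows "madj (U ** rdiag d ** madj U) = U ** rdiag d ** madj U"
  by (simp add: madj_mult madj_madj madj_rdiag matrix_mul_assoc)

lemma rdiag_conj_eigenvalue:
  assumes "unitary U"
  shows "\<exists>x. x \<noteq> 0 \<and> cinner x ((U ** rdiag d ** madj U) *v x) = of_real (d i)"
proof (intro exI conjI)
  have *: "madj U *v (U *v axis i 1) = axis i 1"
    by (simp add: matrix_vector_mul_assoc unitary_mult_cancel[OF assms])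
  then show "U *v axis i 1 \<noteq> 0" by (metis axis_eq_0_iff matrix_vector_mult_0_right one_neq_zero)
  show "cinner (U *v axis i 1) ((U ** rdiag d ** madj U) *v (U *v axis i 1)) = of_real (d i)"
    unfolding cinner_rdiag_conj *
    by (simp add: axis_def if_distrib[of cmod] if_distrib[of "\<lambda>t. t\<^sup>2"] if_distrib[of "\<lambda>t. _ * t"] cong: if_cong)
qed

lemma psd_diagonalization:
  assumes "psd A"
  obtains U d where "unitary U" "A = U ** rdiag d ** madj U" "\<And>i. 0 \<le> d i"
proof -
  obtain U d where U: "unitary U" and A: "A = U ** rdiag d ** madj U"
    using hermitian_diagonalization assms unfolding psd_def by blast
  have "0 \<le> d i" for i
    using rdiag_conj_eigenvalue[OF U, of d i] assms unfolding psd_def A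
    by (metis complex_of_real_nonneg_iff)
  with U A show ?thesis by (rule that)
qed

lemma posdef_diagonalization:
  assumes "posdef A"
  obtains U d where "unitary U" "A = U ** rdiag d ** madj U" "\<And>i. 0 < d i"
proof -
  obtain U d where U: "unitary U" and A: "A = U ** rdiag d ** madj U"
    using hermitian_diagonalization assms unfolding posdef_def by blast
  have "0 < d i" for i
    using rdiag_conj_eigenvalue[OF U, of d i] assms unfolding posdef_def A
    by (metis complex_of_real_pos_iff)
  with U A show ?thesis by (rule that)
qed

lemma psd_rdiag_conj:
  fixes U :: "complex^'n^'n"
  assumes "\<And>i. 0 \<le> d i"
  shows "psd (U ** rdiag d ** madj U)"
  unfolding psd_def cinner_rdiag_conj
  using assms by (simp add: madj_rdiag_conj less_eq_complex_def sum_nonneg)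

lemma posdef_rdiag_conj:
  fixes U :: "complex^'n^'n"
  assumes U: "unitary U" and d: "\<And>i. 0 < d i"
  shows "posdef (U ** rdiag d ** madj U)"
  unfolding posdef_def cinner_rdiag_conj
proof (intro conjI allI impI)
  fix x :: "complex^'n" assume "x \<noteq> 0"
  then have "madj U *v x \<noteq> 0"
    using U by (metis matrix_vector_mul_assoc matrix_vector_mul_lid matrix_vector_mult_0_right unitary_def)
  then obtain i where i: "(madj U *v x) $ i \<noteq> 0" by (auto simp: vec_eq_iff)
  have "0 < (\<Sum>i\<in>UNIV. d i * (cmod ((madj U *v x) $ i))\<^sup>2)"
    by (rule sum_pos2[of _ i]) (use d i in \<open>auto simp: less_imp_le\<close>)
  then show "0 < complex_of_real (\<Sum>i\<in>UNIV. d i * (cmod ((madj U *v x) $ i))\<^sup>2)"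
    by (simp only: complex_of_real_pos_iff)
qed (rule madj_rdiag_conj)

lemma psd_add: "psd P \<Longrightarrow> psd Q \<Longrightarrow> psd (P + Q)"
  by (auto simp: psd_def madj_def vec_eq_iff matrix_vector_mult_add_rdistrib cinner_def
      distrib_left sum.distrib less_eq_complex_def)

lemma cinner_congruence: "cinner x ((madj B ** P ** B) *v x) = cinner (B *v x) (P *v (B *v x))"
  by (simp add: matrix_vector_mul_assoc[symmetric] cinner_madj madj_madj)

lemma psd_congruence:
  assumes "psd P"
  shows "psd (madj B ** P ** B)"
  using assms unfolding psd_def cinner_congruence
  by (simp add: madj_mult madj_madj matrix_mul_assoc)

lemma psd_madj_mult: "psd (madj X ** X)"
  using psd_congruence[OF psd_rdiag_conj[of "\<lambda>_. 1" "mat 1"], of X] by (simp add: rdiag_1 madj_mat_1)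

lemma posdef_imp_psd:
  assumes P: "posdef P"
  shows "psd P"
proof -
  have "0 \<le> cinner x (P *v x)" for x
  proof (cases "x = 0")
    case True
    show ?thesis by (simp add: True cinner_def)
  next
    case False
    with P have "0 < cinner x (P *v x)" unfolding posdef_def by blast
    then show ?thesis by (rule less_imp_le)
  qed
  moreover have "madj P = P" using P unfolding posdef_def by blast
  ultimately show ?thesis unfolding psd_def by blast
qed

lemma posdef_congruence:
  fixes P B :: "complex^'n^'n"
  assumes P: "posdef P" and B: "invertible B"
  shows "posdef (madj B ** P ** B)"
proof -
  obtain B' where B': "B' ** B = mat 1"
    using B unfolding invertible_left_inverse by blast
  have "0 < cinner x ((madj B ** P ** B) *v x)" if x: "x \<noteq> 0" for x
  proof -
    have "B' *v (B *v x) = x" by (simp add: matrix_vector_mul_assoc B')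
    with x have "B *v x \<noteq> 0" by auto
    with P show ?thesis unfolding posdef_def cinner_congruence by blast
  qed
  moreover have "madj P = P" using P unfolding posdef_def by blast
  then have "madj (madj B ** P ** B) = madj B ** P ** B"
    by (simp add: madj_mult madj_madj matrix_mul_assoc)
  ultimately show ?thesis unfolding posdef_def by blast
qed

lemma posdef_mpow:
  assumes "posdef A"
  shows "posdef (mpow A t)"
proof -
  obtain U d where U: "unitary U" and A: "A = U ** rdiag d ** madj U" and d: "\<And>i. 0 < d i"
    using posdef_diagonalization[OF assms] by blast
  have "0 < d i powr t" for i using d[of i] by simp
  then show ?thesis unfolding mpow_eq[OF U A] by (rule posdef_rdiag_conj[OF U])
qed

lemma trace_mult_psd_nonneg:
  assumes "psd P" "psd A"
  shows "0 \<le> trace (P ** A)"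
proof -
  obtain U p where U: "unitary U" and P: "P = U ** rdiag p ** madj U" "\<And>i. 0 \<le> p i"
    using psd_diagonalization[OF assms(1)] by blast
  obtain V a where V: "unitary V" and A: "A = V ** rdiag a ** madj V" "\<And>i. 0 \<le> a i"
    using psd_diagonalization[OF assms(2)] by blast
  have "0 \<le> (\<Sum>i\<in>UNIV. \<Sum>j\<in>UNIV. (cmod ((madj U ** V) $ i $ j))\<^sup>2 * (p i * a j))"
    by (intro sum_nonneg mult_nonneg_nonneg P A) auto
  then show ?thesis unfolding P(1) A(1) trace_rdiag_conj_mult by (simp only: complex_of_real_nonneg_iff)
qed

text \<open>
  All summands of \<open>trace_rdiag_conj_mult\<close> are nonnegative; if they all vanished, they would still
  vanish with the eigenvalues of \<open>A\<close> replaced by 1, which gives the trace of \<open>P\<close>.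
\<close>

lemma trace_mult_posdef_pos:
  assumes "psd P" "posdef A" "trace P \<noteq> 0"
  shows "0 < trace (P ** A)"
proof -
  obtain U p where U: "unitary U" and P: "P = U ** rdiag p ** madj U" "\<And>i. 0 \<le> p i"
    using psd_diagonalization[OF assms(1)] by blast
  obtain V a where V: "unitary V" and A: "A = V ** rdiag a ** madj V" "\<And>i. 0 < a i"
    using posdef_diagonalization[OF assms(2)] by blast
  have "P ** (V ** rdiag (\<lambda>_. 1) ** madj V) = P"
    by (simp add: rdiag_1 unitary_mult_cancel(2)[OF V])
  moreover have "trace (P ** (V ** rdiag (\<lambda>_. 1) ** madj V))
      = of_real (\<Sum>i\<in>UNIV. \<Sum>j\<in>UNIV. (cmod ((madj U ** V) $ i $ j))\<^sup>2 * (p i * 1))"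
    unfolding P(1) by (rule trace_rdiag_conj_mult)
  ultimately have "trace P = of_real (\<Sum>i\<in>UNIV. \<Sum>j\<in>UNIV. (cmod ((madj U ** V) $ i $ j))\<^sup>2 * p i)"
    by simp
  then have "(\<Sum>i\<in>UNIV. \<Sum>j\<in>UNIV. (cmod ((madj U ** V) $ i $ j))\<^sup>2 * p i) \<noteq> 0"
    using assms(3) by (metis of_real_0)
  then obtain i j where ij: "(cmod ((madj U ** V) $ i $ j))\<^sup>2 * p i \<noteq> 0"
    by (meson sum.neutral)
  have pos: "0 \<le> (cmod ((madj U ** V) $ i $ j))\<^sup>2 * (p i * a j)" for i j
    using P(2)[of i] A(2)[of j] by simp
  have "0 < (cmod ((madj U ** V) $ i $ j))\<^sup>2 * (p i * a j)"
    using ij P(2)[of i] A(2)[of j] by (simp add: less_le)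
  then have "0 < (\<Sum>i\<in>UNIV. \<Sum>j\<in>UNIV. (cmod ((madj U ** V) $ i $ j))\<^sup>2 * (p i * a j))"
    by (intro sum_pos2[of _ i] sum_pos2[of _ j] sum_nonneg pos) auto
  then show ?thesis unfolding P(1) A(1) trace_rdiag_conj_mult by (simp only: complex_of_real_pos_iff)
qed

section \<open>A variational formula for the trace of a power\<close>

text \<open>
  The scalar inequality \<open>z\<^sup>r \<le> r z c\<^sup>p\<^sup>-\<^sup>1 + (1 - r) c\<close>, averaged over the squared overlaps \<open>S i j\<close> of the
  eigenbases of \<open>Z\<close> and \<open>C\<close>, whose rows and columns sum to 1. In the theorem \<open>Z\<close> is singular whenever
  the image of \<open>B\<close> is, so only \<open>C\<close> is positive definite here.
\<close>

lemma trace_mpow_le: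
  assumes Z: "psd Z" and C: "posdef C" and p: "0 < p" "p < 1" and r: "r = 1 / (2 - p)"
  shows "trace (mpow Z r) \<le> of_real r * trace (Z ** mpow C (p - 1)) + of_real (1 - r) * trace C"
proof -
  obtain W z where W: "unitary W" and Z: "Z = W ** rdiag z ** madj W" "\<And>i. 0 \<le> z i"
    using psd_diagonalization[OF Z] by blast
  obtain V c where V: "unitary V" and C: "C = V ** rdiag c ** madj V" "\<And>i. 0 < c i"
    using posdef_diagonalization[OF C] by blast
  have r01: "0 < r" "r < 1" using p by (auto simp: r divide_less_eq)
  define S where "S i j = (cmod ((madj W ** V) $ i $ j))\<^sup>2" for i j
  have Zr: "trace (mpow Z r) = of_real (\<Sum>i\<in>UNIV. \<Sum>j\<in>UNIV. S i j * (z i powr r))"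
    using trace_rdiag_conj_mult[of W "\<lambda>i. z i powr r" V "\<lambda>_. 1"]
    by (simp add: mpow_eq[OF W Z(1)] rdiag_1 unitary_mult_cancel[OF V] S_def)
  have ZC: "trace (Z ** mpow C (p - 1)) = of_real (\<Sum>i\<in>UNIV. \<Sum>j\<in>UNIV. S i j * (z i * c j powr (p - 1)))"
    unfolding mpow_eq[OF V C(1)] unfolding Z(1) trace_rdiag_conj_mult S_def ..
  have Ct: "trace C = of_real (\<Sum>i\<in>UNIV. \<Sum>j\<in>UNIV. S i j * c j)"
    using trace_rdiag_conj_mult[of W "\<lambda>_. 1" V c]
    by (simp add: C(1) rdiag_1 unitary_mult_cancel[OF W] S_def)
  have young: "x powr r \<le> r * (x * y powr (p - 1)) + (1 - r) * y" if "0 \<le> x" "0 < y" for x y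
  proof (cases "x = 0")
    case True
    then show ?thesis using that r01 by simp
  next
    case False
    \<comment> \<open>The choice of \<open>r\<close> makes the powers of \<open>y\<close> cancel in the geometric mean.\<close>
    have "(p - 1) * r + (1 - r) = 0" using p by (simp add: r field_simps)
    then have "x powr r = (x * y powr (p - 1)) powr r * y powr (1 - r)"
      using that by (simp add: powr_mult powr_powr flip: powr_add)
    also have "\<dots> \<le> r * (x * y powr (p - 1)) + (1 - r) * y"
      by (rule Youngs_inequality_0) (use False that r01 in auto)
    finally show ?thesis .
  qed
  have "(\<Sum>i\<in>UNIV. \<Sum>j\<in>UNIV. S i j * (z i powr r))
      \<le> (\<Sum>i\<in>UNIV. \<Sum>j\<in>UNIV. S i j * (r * (z i * c j powr (p - 1)) + (1 - r) * c j))"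
    by (intro sum_mono mult_left_mono young Z C) (simp add: S_def)
  also have "\<dots> = r * (\<Sum>i\<in>UNIV. \<Sum>j\<in>UNIV. S i j * (z i * c j powr (p - 1)))
      + (1 - r) * (\<Sum>i\<in>UNIV. \<Sum>j\<in>UNIV. S i j * c j)"
    by (simp add: sum_distrib_left sum.distrib[symmetric] algebra_simps)
  finally show ?thesis
    unfolding Zr ZC Ct of_real_mult[symmetric] of_real_add[symmetric] complex_of_real_le_iff .
qed

lemma trace_mpow_attained:
  assumes Y: "posdef Y" and p: "0 < p" "p < 1" and r: "r = 1 / (2 - p)"
  shows "trace (mpow Y r)
    = of_real r * trace (Y ** mpow (mpow Y r) (p - 1)) + of_real (1 - r) * trace (mpow Y r)"
proof -
  obtain W y where W: "unitary W" and Y: "Y = W ** rdiag y ** madj W" "\<And>i. 0 < y i"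
    using posdef_diagonalization[OF Y] by blast
  have "y i * (y i powr r) powr (p - 1) = y i powr r" for i
  proof -
    have "1 + r * (p - 1) = r" using p by (simp add: r field_simps)
    then have "y i powr (1 + r * (p - 1)) = y i powr r" by simp
    then show ?thesis using Y(2)[of i] by (simp add: powr_powr powr_add)
  qed
  note eq = this
  have "mpow (mpow Y r) (p - 1) = W ** rdiag (\<lambda>i. (y i powr r) powr (p - 1)) ** madj W"
    by (rule mpow_eq[OF W mpow_eq[OF W Y(1)]])
  then have "Y ** mpow (mpow Y r) (p - 1)
      = (W ** rdiag y ** madj W) ** (W ** rdiag (\<lambda>i. (y i powr r) powr (p - 1)) ** madj W)"
    by (rule arg_cong2[OF Y(1)])
  also have "\<dots> = mpow Y r"
    by (simp add: rdiag_conj_mult[OF W] eq mpow_eq[OF W Y(1)])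
  finally have "Y ** mpow (mpow Y r) (p - 1) = mpow Y r" .
  then show ?thesis by (simp add: algebra_simps)
qed

section \<open>Schwarz maps and their Hilbert--Schmidt adjoints\<close>

lemma sum_UNIV_pairs: "(\<Sum>q\<in>UNIV. f q) = (\<Sum>i\<in>UNIV. \<Sum>j\<in>UNIV. f (i, j))"
  by (simp add: sum.cartesian_product UNIV_Times_UNIV[symmetric] del: UNIV_Times_UNIV)

lemma hs_inner_sandwich: "hs_inner (U ** X ** V) Y = hs_inner X (madj U ** Y ** madj V)"
proof -
  have "hs_inner (U ** X ** V) Y = trace (madj V ** (madj X ** madj U ** Y))"
    by (simp add: hs_inner_def madj_mult matrix_mul_assoc)
  also have "\<dots> = trace (madj X ** madj U ** Y ** madj V)"
    by (rule trace_mul_sym)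
  finally show ?thesis by (simp add: hs_inner_def matrix_mul_assoc)
qed

lemma hs_inner_eqI: "(\<And>X. hs_inner X Y = hs_inner X Z) \<Longrightarrow> Y = Z"
proof -
  assume *: "\<And>X. hs_inner X Y = hs_inner X Z"
  have "hs_inner (Y - Z) (Y - Z) = of_real (\<Sum>i\<in>UNIV. \<Sum>j\<in>UNIV. (cmod ((Y - Z) $ i $ j))\<^sup>2)"
    by (simp add: hs_inner_entries complex_norm_square mult.commute del: of_real_power)
  moreover have "hs_inner (Y - Z) (Y - Z) = hs_inner (Y - Z) Y - hs_inner (Y - Z) Z"
    by (simp only: hs_inner_entries vector_minus_component right_diff_distrib sum_subtractf)
  ultimately have "complex_of_real (\<Sum>i\<in>UNIV. \<Sum>j\<in>UNIV. (cmod ((Y - Z) $ i $ j))\<^sup>2) = 0"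
    using *[of "Y - Z"] by simp
  then have "(\<Sum>i\<in>UNIV. \<Sum>j\<in>UNIV. (cmod ((Y - Z) $ i $ j))\<^sup>2) = 0"
    by (simp only: of_real_eq_0_iff)
  then show "Y = Z"
    by (simp add: sum_nonneg_eq_0_iff sum_nonneg vec_eq_iff)
qed

lemma hs_inner_madj: "hs_inner X (madj Y) = cnj (hs_inner (madj X) Y)"
  unfolding hs_inner_entries by (subst sum.swap) (simp add: madj_def)

lemma matrix_matrix_mult_add_rdistrib: "(A + B) ** C = A ** C + B ** (C :: complex^'n^'m)"
  by (simp add: vec_eq_iff matrix_matrix_mult_def distrib_right sum.distrib)

lemma madj_add: "madj (X + Y) = madj X + madj Y"
  by (simp add: vec_eq_iff madj_def)

lemma schwarz_map_linear:
  assumes "schwarz_map \<Phi>"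
  shows "Vector_Spaces.linear mscale mscale \<Phi>"
    "\<Phi> (X + Y) = \<Phi> X + \<Phi> Y" "\<Phi> (X - Y) = \<Phi> X - \<Phi> Y" "\<Phi> (mscale c X) = mscale c (\<Phi> X)"
proof -
  show lin: "Vector_Spaces.linear mscale mscale \<Phi>" using assms by (simp add: schwarz_map_def)
  interpret Vector_Spaces.linear mscale mscale \<Phi> by fact
  show "\<Phi> (X + Y) = \<Phi> X + \<Phi> Y" "\<Phi> (X - Y) = \<Phi> X - \<Phi> Y" "\<Phi> (mscale c X) = mscale c (\<Phi> X)"
    by (rule add diff scale)+
qed

lemma schwarz_map_gram_psd:
  fixes \<Phi> :: "complex^'m^'m \<Rightarrow> complex^'n^'n" and X :: "complex^'m^'m"
  assumes "schwarz_map \<Phi>"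
  shows "psd (\<Phi> (madj X ** X))"
proof -
  have "psd (\<Phi> (madj X ** X) - madj (\<Phi> X) ** \<Phi> X)"
    using assms by (simp add: schwarz_map_def loewner_le_def)
  from psd_add[OF this psd_madj_mult[of "\<Phi> X"]] show ?thesis by simp
qed

lemma schwarz_map_psd:
  fixes \<Phi> :: "complex^'m^'m \<Rightarrow> complex^'n^'n"
  assumes "schwarz_map \<Phi>" "psd P"
  shows "psd (\<Phi> P)"
proof -
  obtain U d where U: "unitary U" and P: "P = U ** rdiag d ** madj U" "\<And>i. 0 \<le> d i"
    using psd_diagonalization[OF assms(2)] by blast
  define Y where "Y = rdiag (\<lambda>i. sqrt (d i)) ** madj U"
  have "madj Y ** Y = U ** (rdiag (\<lambda>i. sqrt (d i)) ** rdiag (\<lambda>i. sqrt (d i))) ** madj U"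
    by (simp add: Y_def madj_mult madj_madj madj_rdiag matrix_mul_assoc)
  also have "\<dots> = P" using P by (simp add: rdiag_mult)
  finally show ?thesis using schwarz_map_gram_psd[OF assms(1), of Y] by simp
qed

text \<open>
  The matrices \<open>\<Phi> (Y\<^sup>* Y)\<close> are Hermitian. Expanding \<open>(Y + 1)\<^sup>* (Y + 1)\<close> shows that
  \<open>\<Phi> (Y\<^sup>*) + \<Phi> Y\<close> is Hermitian for every \<open>Y\<close>; the cases \<open>Y = X\<close> and \<open>Y = \<i> X\<close> together are the claim.
\<close>

lemma schwarz_map_madj:
  fixes \<Phi> :: "complex^'m^'m \<Rightarrow> complex^'n^'n"
  assumes \<Phi>: "schwarz_map \<Phi>"
  shows "\<Phi> (madj X) = madj (\<Phi> X)"
proof -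
  note lin = schwarz_map_linear[OF \<Phi>]
  have gram: "madj (\<Phi> (madj Y ** Y)) = \<Phi> (madj Y ** Y)" for Y :: "complex^'m^'m"
    using schwarz_map_gram_psd[OF \<Phi>, of Y] by (simp add: psd_def)
  have sum: "madj (\<Phi> (madj Y) + \<Phi> Y) = \<Phi> (madj Y) + \<Phi> Y" for Y
  proof -
    have "madj (Y + mat 1) ** (Y + mat 1) = madj Y ** Y + (madj Y + Y) + madj (mat 1) ** mat 1"
      by (simp add: madj_add madj_mat_1 matrix_add_ldistrib matrix_matrix_mult_add_rdistrib algebra_simps)
    then have "\<Phi> (madj Y) + \<Phi> Y = \<Phi> (madj (Y + mat 1) ** (Y + mat 1)) - \<Phi> (madj Y ** Y)
        - \<Phi> (madj (mat 1) ** mat 1)"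
      by (simp add: lin)
    then show ?thesis
      using gram[of "Y + mat 1"] gram[of Y] gram[of "mat 1"] by (simp add: madj_def vec_eq_iff)
  qed
  have eq: "madj (mscale \<i> X) = mscale (- \<i>) (madj X)" by (simp add: vec_eq_iff madj_def mscale_def)
  have 1: "cnj (\<Phi> (madj X) $ j $ i) + cnj (\<Phi> X $ j $ i) = \<Phi> (madj X) $ i $ j + \<Phi> X $ i $ j" for i j
    using arg_cong[OF sum[of X], of "\<lambda>M. M $ i $ j"] by (simp add: madj_def)
  have 2: "\<i> * cnj (\<Phi> (madj X) $ j $ i) - \<i> * cnj (\<Phi> X $ j $ i)
        = - \<i> * \<Phi> (madj X) $ i $ j + \<i> * \<Phi> X $ i $ j" for i j
    using arg_cong[OF sum[of "mscale \<i> X"], of "\<lambda>M. M $ i $ j"]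
    unfolding eq lin by (simp add: mscale_def madj_def)
  have "\<Phi> (madj X) $ i $ j = cnj (\<Phi> X $ j $ i)" for i j
  proof -
    have "\<i> * (cnj (\<Phi> (madj X) $ j $ i) - cnj (\<Phi> X $ j $ i)) = \<i> * (\<Phi> X $ i $ j - \<Phi> (madj X) $ i $ j)"
      using 2[of j i] by (simp add: algebra_simps)
    then have "cnj (\<Phi> (madj X) $ j $ i) - cnj (\<Phi> X $ j $ i) = \<Phi> X $ i $ j - \<Phi> (madj X) $ i $ j"
      by simp
    with 1[of j i] have "2 * \<Phi> (madj X) $ i $ j = 2 * cnj (\<Phi> X $ j $ i)" by algebra
    then show ?thesis by simp
  qed
  then show ?thesis by (simp add: vec_eq_iff madj_def)
qed

lemma hs_adjoint_madj:
  fixes \<Phi> :: "complex^'m^'m \<Rightarrow> complex^'n^'n"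
  assumes \<Phi>: "schwarz_map \<Phi>"
  shows "hs_adjoint \<Phi> (madj Y) = madj (hs_adjoint \<Phi> Y)"
proof (rule hs_inner_eqI)
  note adj = hs_adjoint_works[OF schwarz_map_linear(1)[OF \<Phi>]]
  fix X
  show "hs_inner X (hs_adjoint \<Phi> (madj Y)) = hs_inner X (madj (hs_adjoint \<Phi> Y))"
    by (simp add: adj[symmetric] hs_inner_madj schwarz_map_madj[OF \<Phi>])
qed

text \<open>
  The quadratic form of the adjoint at \<open>x\<close> is \<open>Tr (\<Phi> (x x\<^sup>*) M)\<close>. For \<open>M = 1\<close> it is positive by
  assumption, so \<open>\<Phi> (x x\<^sup>*)\<close> is positive semidefinite with nonzero trace, and its pairing with any
  positive definite matrix is positive.
\<close>

lemma posdef_hs_adjoint: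
  fixes \<Phi> :: "complex^'m^'m \<Rightarrow> complex^'n^'n"
  assumes \<Phi>: "schwarz_map \<Phi>" and 1: "posdef (hs_adjoint \<Phi> (mat 1))" and A: "posdef A"
  shows "posdef (hs_adjoint \<Phi> A)"
  unfolding posdef_def
proof (intro conjI allI impI)
  show "madj (hs_adjoint \<Phi> A) = hs_adjoint \<Phi> A"
    using A by (simp add: hs_adjoint_madj[OF \<Phi>, symmetric] posdef_def)
  fix x :: "complex^'m" assume x: "x \<noteq> 0"
  define P :: "complex^'m^'m" where "P = (\<chi> i j. x $ i * cnj (x $ j))"
  have hP: "madj P = P" by (simp add: P_def madj_def vec_eq_iff mult.commute)
  have "cinner y (P *v y) = cnj (cinner x y) * cinner x y" for y
    by (simp add: cinner_def P_def matrix_vector_mult_def sum_distrib_left sum_distrib_right mult_ac)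
       (rule sum.swap)
  then have "psd P"
    unfolding psd_def by (simp add: hP mult.commute[of "cnj _"] flip: complex_norm_square)
       (simp add: complex_of_real_nonneg_iff flip: of_real_power)
  then have \<Phi>P: "psd (\<Phi> P)" by (rule schwarz_map_psd[OF \<Phi>])
  have form: "cinner x (hs_adjoint \<Phi> M *v x) = trace (\<Phi> P ** M)" for M
  proof -
    have "cinner x (N *v x) = hs_inner P N" for N
      by (simp add: cinner_def hs_inner_entries P_def matrix_vector_mult_def sum_distrib_left mult_ac)
    then have "cinner x (hs_adjoint \<Phi> M *v x) = hs_inner (\<Phi> P) M"
      by (simp add: hs_adjoint_works[OF schwarz_map_linear(1)[OF \<Phi>]])
    also have "\<dots> = trace (\<Phi> P ** M)" using \<Phi>P by (simp add: hs_inner_def psd_def)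
    finally show ?thesis .
  qed
  have "0 < cinner x (hs_adjoint \<Phi> (mat 1) *v x)" using 1 x by (simp add: posdef_def)
  then have "trace (\<Phi> P) \<noteq> 0" by (auto simp: form)
  then show "0 < cinner x (hs_adjoint \<Phi> A *v x)"
    unfolding form by (rule trace_mult_posdef_pos[OF \<Phi>P A])
qed

lemma trace_hs_adjoint:
  assumes "schwarz_map \<Phi>" "unital_map \<Phi>"
  shows "trace (hs_adjoint \<Phi> C) = trace C"
  using hs_adjoint_works[OF schwarz_map_linear(1)[OF assms(1)], of "mat 1" C] assms(2)
  by (simp add: unital_map_def hs_inner_def madj_mat_1)

text \<open>
  The Schwarz inequality for \<open>K\<close>, paired with \<open>C\<close>: the endpoint \<open>p = 0\<close> of the interpolation.
\<close>

lemma schwarz_trace_right: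
  fixes \<Phi> :: "complex^'m^'m \<Rightarrow> complex^'n^'n"
  assumes \<Phi>: "schwarz_map \<Phi>" and C: "psd C"
  shows "trace (madj (\<Phi> K) ** \<Phi> K ** C) \<le> trace (madj K ** K ** hs_adjoint \<Phi> C)"
proof -
  have "psd (\<Phi> (madj K ** K) - madj (\<Phi> K) ** \<Phi> K)"
    using \<Phi> by (simp add: schwarz_map_def loewner_le_def)
  then have "0 \<le> trace ((\<Phi> (madj K ** K) - madj (\<Phi> K) ** \<Phi> K) ** C)"
    using C by (rule trace_mult_psd_nonneg)
  also have "\<dots> = trace (\<Phi> (madj K ** K) ** C) - trace (madj (\<Phi> K) ** \<Phi> K ** C)"
    by (simp add: matrix_matrix_mult_def left_diff_distrib sum_subtractf trace_def)
  also have "trace (\<Phi> (madj K ** K) ** C) = hs_inner (\<Phi> (madj K ** K)) C"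
    using schwarz_map_gram_psd[OF \<Phi>, of K] by (simp add: hs_inner_def psd_def)
  also have "\<dots> = trace (madj K ** K ** hs_adjoint \<Phi> C)"
    unfolding hs_adjoint_works[OF schwarz_map_linear(1)[OF \<Phi>]]
    by (simp add: hs_inner_def madj_mult madj_madj)
  finally show ?thesis by simp
qed

text \<open>
  The Schwarz inequality for \<open>K\<^sup>*\<close>, paired with \<open>A\<close>: the endpoint \<open>p = 1\<close>. It needs that \<open>\<Phi>\<close> commutes
  with taking adjoints.
\<close>

lemma schwarz_trace_left:
  fixes \<Phi> :: "complex^'m^'m \<Rightarrow> complex^'n^'n"
  assumes \<Phi>: "schwarz_map \<Phi>" and A: "psd A"
  shows "trace (madj (\<Phi> K) ** A ** \<Phi> K) \<le> trace (madj K ** hs_adjoint \<Phi> A ** K)"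
proof -
  have cyc: "trace (madj M ** N ** M) = trace (madj (madj M) ** madj M ** N)" for M N :: "complex^'k^'k"
    using trace_mul_sym[of "madj M ** N" M] by (simp add: madj_madj matrix_mul_assoc)
  show ?thesis
    unfolding cyc using schwarz_trace_right[OF \<Phi> A, of "madj K"] by (simp add: schwarz_map_madj[OF \<Phi>])
qed

section \<open>Monotonicity of the trace inequality\<close>

text \<open>
  A form of Lieb's convexity theorem. In the eigenbases of \<open>A\<close> and \<open>C\<close> on one side and of their images
  on the other, \<open>\<Phi>\<close> becomes the map \<open>T\<close> on vectors indexed by pairs. The two Schwarz
  endpoints say that \<open>T\<close> contracts for the weights \<open>a\<close> and for the weights \<open>c\<close>; interpolation gives
  the weights \<open>a\<^sup>p c\<^sup>1\<^sup>-\<^sup>p\<close>, and passing to the adjoint inverts the weights, which produces the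
  exponents \<open>-p\<close> and \<open>p - 1\<close>.
\<close>

lemma lieb_monotone:
  fixes \<Phi> :: "complex^'m^'m \<Rightarrow> complex^'n^'n"
  assumes \<Phi>: "schwarz_map \<Phi>" and p: "0 < p" "p < 1"
    and A: "posdef A" and C: "posdef C"
    and A': "posdef (hs_adjoint \<Phi> A)" and C': "posdef (hs_adjoint \<Phi> C)"
  shows "trace (madj (hs_adjoint \<Phi> B) ** mpow (hs_adjoint \<Phi> A) (- p) ** hs_adjoint \<Phi> B
            ** mpow (hs_adjoint \<Phi> C) (p - 1))
       \<le> trace (madj B ** mpow A (- p) ** B ** mpow C (p - 1))"
proof -
  obtain U a where U: "unitary U" and Ad: "A = U ** rdiag a ** madj U" and a: "\<And>i. 0 < a i"
    using posdef_diagonalization[OF A] by blast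
  obtain V c where V: "unitary V" and Cd: "C = V ** rdiag c ** madj V" and c: "\<And>i. 0 < c i"
    using posdef_diagonalization[OF C] by blast
  obtain U' a' where U': "unitary U'" and Ad': "hs_adjoint \<Phi> A = U' ** rdiag a' ** madj U'"
    and a': "\<And>i. 0 < a' i"
    using posdef_diagonalization[OF A'] by blast
  obtain V' c' where V': "unitary V'" and Cd': "hs_adjoint \<Phi> C = V' ** rdiag c' ** madj V'"
    and c': "\<And>i. 0 < c' i"
    using posdef_diagonalization[OF C'] by blast
  define K :: "('m \<times> 'm \<Rightarrow> complex) \<Rightarrow> complex^'m^'m"
    where "K x = U' ** (\<chi> i j. x (i, j)) ** madj V'" for x
  define T :: "('m \<times> 'm \<Rightarrow> complex) \<Rightarrow> 'n \<times> 'n \<Rightarrow> complex"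
    where "T x = (\<lambda>(i, j). (madj U ** \<Phi> (K x) ** V) $ i $ j)" for x
  have x: "(\<chi> i j. x (i, j)) = madj U' ** K x ** V'" for x
    by (simp add: K_def unitary_mult_cancel[OF V'] matrix_mul_assoc[symmetric])
       (simp add: matrix_mul_assoc unitary_mult_cancel[OF U'])
  have form_x: "trace (madj (K x) ** (U' ** rdiag f ** madj U') ** K x ** (V' ** rdiag g ** madj V'))
      = of_real (\<Sum>q\<in>UNIV. (cmod (x q))\<^sup>2 * (f (fst q) * g (snd q)))" for x f g
    unfolding trace_weighted x[symmetric] sum_UNIV_pairs by simp
  have form_T: "trace (madj (\<Phi> (K x)) ** (U ** rdiag f ** madj U) ** \<Phi> (K x) ** (V ** rdiag g ** madj V))
      = of_real (\<Sum>q\<in>UNIV. (cmod (T x q))\<^sup>2 * (f (fst q) * g (snd q)))" for x f g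
    unfolding trace_weighted sum_UNIV_pairs by (simp add: T_def)
  have one: "W ** rdiag (\<lambda>_. 1) ** madj W = mat 1" if "unitary W" for W :: "complex^'k^'k"
    by (simp add: rdiag_1 unitary_mult_cancel[OF that])
  have T_add: "T (\<lambda>q. x q + y q) = (\<lambda>q. T x q + T y q)" for x y
  proof -
    have "(\<chi> i j. x (i, j) + y (i, j)) = (\<chi> i j. x (i, j)) + (\<chi> i j. y (i, j))"
      by (simp add: vec_eq_iff)
    then have "K (\<lambda>q. x q + y q) = K x + K y"
      by (simp add: K_def matrix_add_ldistrib matrix_matrix_mult_add_rdistrib)
    then show ?thesis
      by (simp add: T_def schwarz_map_linear[OF \<Phi>] matrix_add_ldistrib matrix_matrix_mult_add_rdistrib fun_eq_iff)
  qed
  have left: "(\<Sum>q\<in>UNIV. (cmod (T x q))\<^sup>2 * a (fst q)) \<le> (\<Sum>q\<in>UNIV. (cmod (x q))\<^sup>2 * a' (fst q))" for x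
    using schwarz_trace_left[OF \<Phi> posdef_imp_psd[OF A], of "K x"]
      form_x[of x a' "\<lambda>_. 1"] form_T[of x a "\<lambda>_. 1"]
    by (simp add: one[OF V] one[OF V'] Ad[symmetric] Ad'[symmetric] complex_of_real_le_iff
        del: of_real_sum)
  have right: "(\<Sum>q\<in>UNIV. (cmod (T x q))\<^sup>2 * c (snd q)) \<le> (\<Sum>q\<in>UNIV. (cmod (x q))\<^sup>2 * c' (snd q))" for x
    using schwarz_trace_right[OF \<Phi> posdef_imp_psd[OF C], of "K x"]
      form_x[of x "\<lambda>_. 1" c'] form_T[of x "\<lambda>_. 1" c]
    by (simp add: one[OF U] one[OF U'] Cd[symmetric] Cd'[symmetric] complex_of_real_le_iff
        del: of_real_sum)
  have interp: "(\<Sum>q\<in>UNIV. (cmod (T x q))\<^sup>2 * (a (fst q) powr p * c (snd q) powr (1 - p)))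
       \<le> (\<Sum>q\<in>UNIV. (cmod (x q))\<^sup>2 * (a' (fst q) powr p * c' (snd q) powr (1 - p)))" for x
    by (rule weighted_interpolation[OF T_add _ _ _ _ left right p]) (simp_all add: a c a' c')
  define y where "y = (\<lambda>(i, j). (madj U ** B ** V) $ i $ j)"
  define z where "z = (\<lambda>(i, j). (madj U' ** hs_adjoint \<Phi> B ** V') $ i $ j)"
  have adj: "(\<Sum>q\<in>UNIV. cnj (T x q) * y q) = (\<Sum>q\<in>UNIV. cnj (x q) * z q)" for x
  proof -
    have "(\<Sum>q\<in>UNIV. cnj (T x q) * y q) = hs_inner (madj U ** \<Phi> (K x) ** V) (madj U ** B ** V)"
      by (simp add: sum_UNIV_pairs hs_inner_entries T_def y_def)
    also have "\<dots> = hs_inner (\<Phi> (K x)) (U ** (madj U ** B ** V) ** madj V)"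
      by (simp add: hs_inner_sandwich madj_madj)
    also have "U ** (madj U ** B ** V) ** madj V = B"
      by (simp add: matrix_mul_assoc unitary_mult_cancel[OF V] unitary_mult_cancel[OF U])
    also have "hs_inner (\<Phi> (K x)) B = hs_inner (K x) (hs_adjoint \<Phi> B)"
      by (rule hs_adjoint_works[OF schwarz_map_linear(1)[OF \<Phi>]])
    also have "\<dots> = hs_inner (\<chi> i j. x (i, j)) (madj U' ** hs_adjoint \<Phi> B ** V')"
      by (simp add: K_def hs_inner_sandwich madj_madj)
    also have "\<dots> = (\<Sum>q\<in>UNIV. cnj (x q) * z q)"
      by (simp add: sum_UNIV_pairs hs_inner_entries z_def)
    finally show ?thesis .
  qed
  have "(\<Sum>q\<in>UNIV. (cmod (z q))\<^sup>2 / (a' (fst q) powr p * c' (snd q) powr (1 - p)))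
      \<le> (\<Sum>q\<in>UNIV. (cmod (y q))\<^sup>2 / (a (fst q) powr p * c (snd q) powr (1 - p)))"
    by (rule weighted_norm_le_adjoint[OF _ _ interp adj])
       (metis a c a' c' mult_pos_pos powr_gt_zero less_irrefl)+
  moreover have "s / (v powr p * w powr (1 - p)) = s * (v powr (- p) * w powr (p - 1))" for s v w :: real
    using powr_minus_divide[of v p] powr_minus_divide[of w "1 - p"] by simp
  ultimately have main: "(\<Sum>q\<in>UNIV. (cmod (z q))\<^sup>2 * (a' (fst q) powr (- p) * c' (snd q) powr (p - 1)))
      \<le> (\<Sum>q\<in>UNIV. (cmod (y q))\<^sup>2 * (a (fst q) powr (- p) * c (snd q) powr (p - 1)))"
    by simp
  have "trace (madj B ** mpow A (- p) ** B ** mpow C (p - 1))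
      = of_real (\<Sum>q\<in>UNIV. (cmod (y q))\<^sup>2 * (a (fst q) powr (- p) * c (snd q) powr (p - 1)))"
    unfolding mpow_eq[OF U Ad] mpow_eq[OF V Cd] trace_weighted sum_UNIV_pairs by (simp add: y_def)
  moreover have "trace (madj (hs_adjoint \<Phi> B) ** mpow (hs_adjoint \<Phi> A) (- p) ** hs_adjoint \<Phi> B
        ** mpow (hs_adjoint \<Phi> C) (p - 1))
      = of_real (\<Sum>q\<in>UNIV. (cmod (z q))\<^sup>2 * (a' (fst q) powr (- p) * c' (snd q) powr (p - 1)))"
    unfolding mpow_eq[OF U' Ad'] mpow_eq[OF V' Cd'] trace_weighted sum_UNIV_pairs by (simp add: z_def)
  ultimately show ?thesis using main by (simp only: complex_of_real_le_iff)
qed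

theorem theorem4p1:
  fixes p :: real
    and \<Phi> :: "complex^'m^'m \<Rightarrow> complex^'n^'n"
    and A B :: "complex^'n^'n"
  assumes "0 < p" and "p < 1"
    and "schwarz_map \<Phi>" and "unital_map \<Phi>"
    and "posdef (hs_adjoint \<Phi> (mat 1))"
    and "posdef A" and "invertible B"
  shows "trace (mpow (madj B ** mpow A (- p) ** B) (1 / (2 - p)))
       \<ge> trace (mpow (madj (hs_adjoint \<Phi> B) ** mpow (hs_adjoint \<Phi> A) (- p) ** hs_adjoint \<Phi> B)
                     (1 / (2 - p)))"
proof -
  define r where "r = 1 / (2 - p)"
  define Y where "Y = madj B ** mpow A (- p) ** B"
  define Z where "Z = madj (hs_adjoint \<Phi> B) ** mpow (hs_adjoint \<Phi> A) (- p) ** hs_adjoint \<Phi> B"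
  \<comment> \<open>The optimal matrix in the variational formula for \<open>Y\<close>.\<close>
  define C where "C = mpow Y r"
  note pd = posdef_hs_adjoint[OF \<open>schwarz_map \<Phi>\<close> \<open>posdef (hs_adjoint \<Phi> (mat 1))\<close>]
  have Y: "posdef Y"
    unfolding Y_def by (intro posdef_congruence posdef_mpow assms)
  then have C: "posdef C" unfolding C_def by (rule posdef_mpow)
  have Z: "psd Z"
    unfolding Z_def by (intro psd_congruence posdef_imp_psd posdef_mpow pd assms)
  have "trace (mpow Z r) \<le> of_real r * trace (Z ** mpow (hs_adjoint \<Phi> C) (p - 1))
      + of_real (1 - r) * trace (hs_adjoint \<Phi> C)"
    by (rule trace_mpow_le[OF Z pd[OF C] assms(1,2) r_def])
  also have "\<dots> \<le> of_real r * trace (Y ** mpow C (p - 1)) + of_real (1 - r) * trace C"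
  proof -
    have "trace (Z ** mpow (hs_adjoint \<Phi> C) (p - 1)) \<le> trace (Y ** mpow C (p - 1))"
      unfolding Z_def Y_def by (intro lieb_monotone pd C assms)
    moreover have "0 \<le> complex_of_real r"
      using assms(2) unfolding complex_of_real_nonneg_iff by (simp add: r_def)
    ultimately show ?thesis
      by (simp add: trace_hs_adjoint assms mult_left_mono)
  qed
  also have "\<dots> = trace (mpow Y r)"
    unfolding C_def by (rule trace_mpow_attained[OF Y assms(1,2) r_def, symmetric])
  finally show ?thesis unfolding r_def Y_def Z_def .
qed

end
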